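(* Let $k$ be a perfect field of characteristic $p>0$ and let $R:=k[x_1,\dots,x_n]$ be a polynomial ring over $k$. Then there is a unique ring anti-automorphism on $D_{R|k}$ that fixes $R$ (i.e. that restricts to the identity on $R\subseteq D_{R|k}$).
   Context: For a commutative ring $k$ and a commutative $k$-algebra $R$, identify $f\in R$ with the operator $g\mapsto fg$ on $R$, so that $R\subseteq \operatorname{End}_k(R)$. Define inductively $D^0_{R|k}=R$ and $D^n_{R|k}=\{\xi\in\operatorname{End}_k(R): [\xi,f]\in D^{n-1}_{R|k}\text{ for all } f\in R\}$. The ring of $k$-linear differential operators on $R$ is $D_{R|k}=\bigcup_{n\ge 0}D^n_{R|k}\subseteq\operatorname{End}_k(R)$. A ring anti-automorphism of a ring $A$ is a bijective additive map $\Phi:A\to A$ with $\Phi(1)=1$ and $\Phi(xy)=\Phi(y)\Phi(x)$ for all $x,y\in A$. *)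

theory Defs
  imports "HOL-Algebra.Algebraic_Closure_Type" "HOL-Library.Poly_Mapping"
begin

section \<open>Differential operators on a commutative algebra\<close>

text \<open>
  Endomorphisms of \<open>M\<close> are represented by functions that are \<open>undefined\<close> outside \<open>carrier M\<close>, so
  that equality of endomorphisms is equality on \<open>carrier M\<close>.
\<close>

definition linear_endos ::
    "('k, 'a) ring_scheme \<Rightarrow> ('k, 'r, 'b) module_scheme \<Rightarrow> ('r \<Rightarrow> 'r) set" where
  "linear_endos K M = {\<xi> \<in> carrier M \<rightarrow>\<^sub>E carrier M.
     (\<forall>x\<in>carrier M. \<forall>y\<in>carrier M. \<xi> (x \<oplus>\<^bsub>M\<^esub> y) = \<xi> x \<oplus>\<^bsub>M\<^esub> \<xi> y) \<and>
     (\<forall>c\<in>carrier K. \<forall>x\<in>carrier M. \<xi> (c \<odot>\<^bsub>M\<^esub> x) = c \<odot>\<^bsub>M\<^esub> \<xi> x)}"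

definition End_ring ::
    "('k, 'a) ring_scheme \<Rightarrow> ('k, 'r, 'b) module_scheme \<Rightarrow> ('r \<Rightarrow> 'r) ring" where
  "End_ring K M = \<lparr>
     carrier = linear_endos K M,
     monoid.mult = (\<lambda>\<xi> \<eta>. compose (carrier M) \<xi> \<eta>),
     one = (\<lambda>x\<in>carrier M. x),
     ring.zero = (\<lambda>x\<in>carrier M. \<zero>\<^bsub>M\<^esub>),
     add = (\<lambda>\<xi> \<eta>. \<lambda>x\<in>carrier M. \<xi> x \<oplus>\<^bsub>M\<^esub> \<eta> x)\<rparr>"

definition mult_op :: "('r, 'b) ring_scheme \<Rightarrow> 'r \<Rightarrow> 'r \<Rightarrow> 'r" where
  "mult_op R f = (\<lambda>g\<in>carrier R. f \<otimes>\<^bsub>R\<^esub> g)"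

definition commutator :: "('a, 'b) ring_scheme \<Rightarrow> 'a \<Rightarrow> 'a \<Rightarrow> 'a" where
  "commutator A x y = x \<otimes>\<^bsub>A\<^esub> y \<ominus>\<^bsub>A\<^esub> y \<otimes>\<^bsub>A\<^esub> x"

primrec diff_ops_le ::
    "('k, 'a) ring_scheme \<Rightarrow> ('k, 'r, 'b) module_scheme \<Rightarrow> nat \<Rightarrow> ('r \<Rightarrow> 'r) set" where
  "diff_ops_le K R 0 = mult_op R ` carrier R"
| "diff_ops_le K R (Suc n) = {\<xi> \<in> carrier (End_ring K R).
     \<forall>f\<in>carrier R. commutator (End_ring K R) \<xi> (mult_op R f) \<in> diff_ops_le K R n}"

definition diff_op_ring ::
    "('k, 'a) ring_scheme \<Rightarrow> ('k, 'r, 'b) module_scheme \<Rightarrow> ('r \<Rightarrow> 'r) ring" where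
  "diff_op_ring K R = (End_ring K R)\<lparr>carrier := (\<Union>n. diff_ops_le K R n)\<rparr>"


section \<open>Ring anti-automorphisms\<close>

text \<open>
  Membership in \<open>extensional\<close> makes an anti-automorphism determined by its values on \<open>carrier A\<close>,
  so that uniqueness of such maps can be stated with equality of functions.
\<close>

definition ring_anti_automorphisms :: "('a, 'b) ring_scheme \<Rightarrow> ('a \<Rightarrow> 'a) set" where
  "ring_anti_automorphisms A = {\<Phi> \<in> extensional (carrier A).
     bij_betw \<Phi> (carrier A) (carrier A) \<and>
     (\<forall>x\<in>carrier A. \<forall>y\<in>carrier A. \<Phi> (x \<oplus>\<^bsub>A\<^esub> y) = \<Phi> x \<oplus>\<^bsub>A\<^esub> \<Phi> y) \<and>
     \<Phi> \<one>\<^bsub>A\<^esub> = \<one>\<^bsub>A\<^esub> \<and>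
     (\<forall>x\<in>carrier A. \<forall>y\<in>carrier A. \<Phi> (x \<otimes>\<^bsub>A\<^esub> y) = \<Phi> y \<otimes>\<^bsub>A\<^esub> \<Phi> x)}"


section \<open>Perfect fields and polynomial rings\<close>

definition perfect_field :: "'k::field itself \<Rightarrow> bool" where
  "perfect_field _ \<longleftrightarrow> CHAR('k) = 0 \<or> (\<forall>a::'k. \<exists>b. b ^ CHAR('k) = a)"

text \<open>
  Exponent vectors are finitely supported functions \<open>nat \<Rightarrow>\<^sub>0 nat\<close>; the polynomials in the
  \<open>n\<close> variables with indices \<open>0, \<dots>, n - 1\<close> are those in whose monomials no other variable occurs.
  For \<open>n = 0\<close> this is the ring of constants.
\<close>

definition mpoly_ring :: "nat \<Rightarrow> ('k::field, (nat \<Rightarrow>\<^sub>0 nat) \<Rightarrow>\<^sub>0 'k) module" where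
  "mpoly_ring n = \<lparr>
     carrier = {P. \<forall>m\<in>Poly_Mapping.keys P. Poly_Mapping.keys m \<subseteq> {..<n}},
     monoid.mult = (*), one = 1, ring.zero = 0, add = (+),
     module.smult = (\<lambda>c P. Poly_Mapping.single 0 c * P)\<rparr>"


section \<open>Basic properties\<close>

lemma linear_endosI:
  assumes "\<xi> \<in> extensional (carrier M)"
    and "\<And>x. x \<in> carrier M \<Longrightarrow> \<xi> x \<in> carrier M"
    and "\<And>x y. x \<in> carrier M \<Longrightarrow> y \<in> carrier M \<Longrightarrow> \<xi> (x \<oplus>\<^bsub>M\<^esub> y) = \<xi> x \<oplus>\<^bsub>M\<^esub> \<xi> y"
    and "\<And>c x. c \<in> carrier K \<Longrightarrow> x \<in> carrier M \<Longrightarrow> \<xi> (c \<odot>\<^bsub>M\<^esub> x) = c \<odot>\<^bsub>M\<^esub> \<xi> x"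
  shows "\<xi> \<in> linear_endos K M"
  using assms by (auto simp: linear_endos_def PiE_def)

lemma linear_endosD:
  assumes "\<xi> \<in> linear_endos K M"
  shows "\<xi> \<in> extensional (carrier M)"
    and "x \<in> carrier M \<Longrightarrow> \<xi> x \<in> carrier M"
    and "x \<in> carrier M \<Longrightarrow> y \<in> carrier M \<Longrightarrow> \<xi> (x \<oplus>\<^bsub>M\<^esub> y) = \<xi> x \<oplus>\<^bsub>M\<^esub> \<xi> y"
    and "c \<in> carrier K \<Longrightarrow> x \<in> carrier M \<Longrightarrow> \<xi> (c \<odot>\<^bsub>M\<^esub> x) = c \<odot>\<^bsub>M\<^esub> \<xi> x"
  using assms by (auto simp: linear_endos_def PiE_def)

lemma linear_endos_eqI:
  assumes "\<xi> \<in> linear_endos K M" "\<eta> \<in> linear_endos K M"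
    and "\<And>x. x \<in> carrier M \<Longrightarrow> \<xi> x = \<eta> x"
  shows "\<xi> = \<eta>"
  using assms by (intro extensionalityI[of _ "carrier M"]) (auto dest: linear_endosD(1))

context module
begin

lemma linear_endos_zero: "(\<lambda>x\<in>carrier M. \<zero>\<^bsub>M\<^esub>) \<in> linear_endos R M"
  by (rule linear_endosI) auto

lemma linear_endos_one: "(\<lambda>x\<in>carrier M. x) \<in> linear_endos R M"
  by (rule linear_endosI) auto

lemma linear_endos_add:
  assumes "\<xi> \<in> linear_endos R M" "\<eta> \<in> linear_endos R M"
  shows "(\<lambda>x\<in>carrier M. \<xi> x \<oplus>\<^bsub>M\<^esub> \<eta> x) \<in> linear_endos R M"
  using assms
  by (intro linear_endosI) (auto simp: linear_endosD smult_r_distr M.add.m_ac)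

lemma linear_endos_uminus:
  assumes "\<xi> \<in> linear_endos R M"
  shows "(\<lambda>x\<in>carrier M. \<ominus>\<^bsub>M\<^esub> \<xi> x) \<in> linear_endos R M"
  using assms
  by (intro linear_endosI) (auto simp: linear_endosD M.minus_add M.add.m_ac smult_r_minus)

lemma linear_endos_compose:
  assumes "\<xi> \<in> linear_endos R M" "\<eta> \<in> linear_endos R M"
  shows "compose (carrier M) \<xi> \<eta> \<in> linear_endos R M"
  using assms
  by (intro linear_endosI) (auto simp: linear_endosD compose_def)

lemma End_ring_is_ring: "ring (End_ring R M)"
proof (rule ringI)
  show "abelian_group (End_ring R M)"
  proof (rule abelian_groupI)
    fix \<xi> assume "\<xi> \<in> carrier (End_ring R M)"
    then have \<xi>: "\<xi> \<in> linear_endos R M" by (simp add: End_ring_def)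
    show "\<exists>\<eta>\<in>carrier (End_ring R M). \<eta> \<oplus>\<^bsub>End_ring R M\<^esub> \<xi> = \<zero>\<^bsub>End_ring R M\<^esub>"
      by (rule bexI[of _ "\<lambda>x\<in>carrier M. \<ominus>\<^bsub>M\<^esub> \<xi> x"])
        (use \<xi> in \<open>auto simp: End_ring_def linear_endos_uminus linear_endosD M.l_neg
          intro!: restrict_ext\<close>)
  next
    fix \<xi> assume "\<xi> \<in> carrier (End_ring R M)"
    then have \<xi>: "\<xi> \<in> linear_endos R M" by (simp add: End_ring_def)
    have "(\<lambda>x\<in>carrier M. (\<lambda>x\<in>carrier M. \<zero>\<^bsub>M\<^esub>) x \<oplus>\<^bsub>M\<^esub> \<xi> x) = \<xi>"
      by (rule linear_endos_eqI[OF linear_endos_add[OF linear_endos_zero \<xi>] \<xi>])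
        (simp add: linear_endosD[OF \<xi>])
    then show "\<zero>\<^bsub>End_ring R M\<^esub> \<oplus>\<^bsub>End_ring R M\<^esub> \<xi> = \<xi>"
      by (simp add: End_ring_def)
  qed (auto simp: End_ring_def linear_endos_zero linear_endos_add linear_endosD
        M.add.m_ac intro!: restrict_ext)
  show "monoid (End_ring R M)"
  proof (rule monoidI)
    fix \<xi> \<eta> \<zeta>
    assume "\<zeta> \<in> carrier (End_ring R M)"
    then have \<zeta>: "\<zeta> \<in> linear_endos R M" by (simp add: End_ring_def)
    then show "\<xi> \<otimes>\<^bsub>End_ring R M\<^esub> \<eta> \<otimes>\<^bsub>End_ring R M\<^esub> \<zeta>
        = \<xi> \<otimes>\<^bsub>End_ring R M\<^esub> (\<eta> \<otimes>\<^bsub>End_ring R M\<^esub> \<zeta>)"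
      by (auto simp: End_ring_def compose_def linear_endosD intro!: restrict_ext)
    show "\<one>\<^bsub>End_ring R M\<^esub> \<otimes>\<^bsub>End_ring R M\<^esub> \<zeta> = \<zeta>"
      using \<zeta> by (auto simp: End_ring_def linear_endosD intro!: Id_compose)
    show "\<zeta> \<otimes>\<^bsub>End_ring R M\<^esub> \<one>\<^bsub>End_ring R M\<^esub> = \<zeta>"
      using \<zeta> by (auto simp: End_ring_def linear_endosD intro!: compose_Id)
  qed (auto simp: End_ring_def linear_endos_one linear_endos_compose)
qed (auto simp: End_ring_def linear_endosD compose_def intro!: restrict_ext)

lemma commutator_End_ring_apply:
  assumes "\<xi> \<in> linear_endos R M" "\<eta> \<in> linear_endos R M" "x \<in> carrier M"
  shows "commutator (End_ring R M) \<xi> \<eta> x = \<xi> (\<eta> x) \<ominus>\<^bsub>M\<^esub> \<eta> (\<xi> x)"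
proof -
  interpret E: ring "End_ring R M" by (rule End_ring_is_ring)
  have *: "\<ominus>\<^bsub>End_ring R M\<^esub> \<zeta> = (\<lambda>x\<in>carrier M. \<ominus>\<^bsub>M\<^esub> \<zeta> x)" if "\<zeta> \<in> linear_endos R M" for \<zeta>
    by (rule E.minus_equality)
      (use that in \<open>auto simp: End_ring_def linear_endos_uminus linear_endosD M.l_neg
          intro!: restrict_ext\<close>)
  have "commutator (End_ring R M) \<xi> \<eta> x
      = (compose (carrier M) \<xi> \<eta> \<oplus>\<^bsub>End_ring R M\<^esub>
          (\<ominus>\<^bsub>End_ring R M\<^esub> (compose (carrier M) \<eta> \<xi>))) x"
    by (simp add: commutator_def a_minus_def End_ring_def)
  also have "\<dots> = \<xi> (\<eta> x) \<ominus>\<^bsub>M\<^esub> \<eta> (\<xi> x)"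
    using assms
    by (simp add: * linear_endos_compose) (simp add: End_ring_def compose_def a_minus_def)
  finally show ?thesis .
qed

end

lemma mpoly_ring_simps [simp]:
  "P \<otimes>\<^bsub>mpoly_ring n\<^esub> Q = P * Q" "\<one>\<^bsub>mpoly_ring n\<^esub> = 1"
  "P \<oplus>\<^bsub>mpoly_ring n\<^esub> Q = P + Q" "\<zero>\<^bsub>mpoly_ring n\<^esub> = 0"
  "c \<odot>\<^bsub>mpoly_ring n\<^esub> P = Poly_Mapping.single 0 c * P"
  by (simp_all add: mpoly_ring_def)

lemma mpoly_ring_algebra:
  "algebra (ring_of_type_algebra :: 'k::field ring) (mpoly_ring n :: ('k, _) module)"
proof -
  let ?R = "mpoly_ring n :: ('k, _) module"
  have add: "P + Q \<in> carrier ?R" if "P \<in> carrier ?R" "Q \<in> carrier ?R" for P Q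
    using that Poly_Mapping.keys_add[of P Q] by (auto simp: mpoly_ring_def)
  have mult: "P * Q \<in> carrier ?R" if "P \<in> carrier ?R" "Q \<in> carrier ?R" for P Q
  proof -
    have "Poly_Mapping.keys m \<subseteq> {..<n}" if m: "m \<in> Poly_Mapping.keys (P * Q)" for m
    proof -
      obtain a b where "m = a + b" "a \<in> Poly_Mapping.keys P" "b \<in> Poly_Mapping.keys Q"
        using keys_mult[of P Q] m by blast
      then show ?thesis
        using \<open>P \<in> carrier ?R\<close> \<open>Q \<in> carrier ?R\<close> Poly_Mapping.keys_add[of a b]
        by (fastforce simp: mpoly_ring_def)
    qed
    then show ?thesis by (simp add: mpoly_ring_def)
  qed
  have single: "Poly_Mapping.single 0 c \<in> carrier ?R" for c
    by (simp add: mpoly_ring_def)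
  have const: "0 \<in> carrier ?R" "1 \<in> carrier ?R"
    by (simp_all add: mpoly_ring_def)
  have uminus: "- P \<in> carrier ?R" if "P \<in> carrier ?R" for P
    using that by (simp add: mpoly_ring_def)
  have "cring ?R"
  proof (rule cringI)
    show "abelian_group ?R"
    proof (rule abelian_groupI)
      fix P assume "P \<in> carrier ?R"
      then show "\<exists>Q\<in>carrier ?R. Q \<oplus>\<^bsub>?R\<^esub> P = \<zero>\<^bsub>?R\<^esub>"
        by (intro bexI[of _ "- P"]) (auto simp: uminus)
    qed (simp_all add: add const algebra_simps)
    show "comm_monoid ?R"
      by (rule comm_monoidI) (simp_all add: mult const algebra_simps)
  qed (simp add: algebra_simps)
  moreover have "Poly_Mapping.single 0 (a * b) * P
      = Poly_Mapping.single 0 a * (Poly_Mapping.single 0 b * P)" for a b :: 'k and P :: "(nat \<Rightarrow>\<^sub>0 nat) \<Rightarrow>\<^sub>0 'k"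
    using mult_single[of "0 :: nat \<Rightarrow>\<^sub>0 nat" a 0 b] by (simp flip: mult.assoc)
  ultimately show ?thesis
    by (intro algebraI cring_from_type_algebra)
      (simp_all add: add mult single ring_of_type_algebra_def single_add distrib_left distrib_right
        mult.assoc)
qed

end

theory Submission
  imports Defs
begin

text \<open>
  For \<open>q = p\<^sup>e\<close> let \<open>\<tau>\<close> be the divided power derivative of exponent \<open>(q - 1, \<dots>, q - 1)\<close>. Modulo \<open>p\<close> it
  is the trace \<open>R \<rightarrow> R\<^sup>q\<close> dual to the basis of monomials \<open>x\<^sup>a\<close>, \<open>a\<^sub>i < q\<close>. Since commutators with
  polynomials lower the order, an operator of order at most \<open>m\<close> commutes with all powers of exponent
  \<open>p ^ m\<close>. Conversely, an operator \<open>\<xi>\<close> commuting with the \<open>x\<^sub>i ^ q\<close> is the sum of the operators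
  \<open>\<xi>(x\<^sup>a) \<circ> \<tau> \<circ> x\<^sup>b\<close> with \<open>a\<^sub>i + b\<^sub>i = q - 1\<close>, and so it is a differential operator.

  Existence: the symmetric form \<open>(f, g) \<mapsto> \<tau>(f g)\<close> is perfect, multiplications and \<open>\<tau>\<close> are self-adjoint
  for it, and the forms for different \<open>q\<close> are compatible. Taking adjoints is the required map.

  Uniqueness: let \<open>\<Phi>\<close> be an anti-automorphism fixing \<open>R\<close>, and \<open>\<partial>\<close> the divided power derivative of
  exponent \<open>a\<close>. By induction on \<open>\<bar>a\<bar>\<close>, the operator \<open>\<Phi>(\<partial>) - (-1) ^ \<bar>a\<bar> \<partial>\<close> commutes with the variables,
  so it is multiplication by some \<open>g\<close>. If \<open>g \<noteq> 0\<close>, then \<open>\<Phi>(\<partial>)\<close> is injective by comparison of leading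
  terms; but \<open>\<Phi>(\<partial>) \<Phi>(\<tau>) = \<Phi>(\<tau> \<partial>) = 0\<close> for large \<open>q\<close>. So \<open>\<Phi>\<close> is determined on \<open>\<tau>\<close> and on \<open>R\<close>,
  and hence everywhere.
\<close>

subsection \<open>Binomial coefficients modulo a prime\<close>

text \<open>From \<open>j * (p ^ e choose j) = p ^ e * ((p ^ e - 1) choose (j - 1))\<close>: if
  \<open>p\<close> did not divide the binomial, all of \<open>p ^ e\<close> would divide
  \<open>j\<close>, which is too small.\<close>

lemma prime_power_dvd_choose:
  fixes p :: nat
  assumes "prime p" "0 < j" "j < p ^ e"
  shows "p dvd (p ^ e choose j)"
proof (rule ccontr)
  assume "\<not> p dvd (p ^ e choose j)"
  then have "coprime (p ^ e) (p ^ e choose j)"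
    using assms(1) by (simp add: prime_imp_coprime)
  moreover have "j * (p ^ e choose j) = p ^ e * ((p ^ e - 1) choose (j - 1))"
    using times_binomial_minus1_eq[OF assms(2)] by simp
  ultimately have "p ^ e dvd j"
    by (metis coprime_dvd_mult_left_iff dvd_triv_left)
  with assms show False by (auto dest: dvd_imp_le)
qed

text \<open>Vandermonde's identity expands the left side over \<open>j \<le> k < p ^ e\<close>, and
  every term with \<open>j > 0\<close> is divisible by \<open>p\<close>.\<close>

lemma of_nat_choose_add_prime_power:
  assumes "prime p" "CHAR('k::comm_semiring_1) = p" "k < p ^ e"
  shows "(of_nat ((N + p ^ e) choose k) :: 'k) = of_nat (N choose k)"
proof -
  have z: "(of_nat (p ^ e choose j) :: 'k) = 0" if "0 < j" "j \<le> k" for j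
    using prime_power_dvd_choose[OF assms(1), of j e] that assms
    by (auto simp: of_nat_eq_0_iff_char_dvd)
  have "(N + p ^ e) choose k = (\<Sum>j\<le>k. (p ^ e choose j) * (N choose (k - j)))"
    by (simp add: vandermonde add.commute)
  then have "(of_nat ((N + p ^ e) choose k) :: 'k)
      = (\<Sum>j\<le>k. of_nat (p ^ e choose j) * of_nat (N choose (k - j)))"
    by simp
  also have "\<dots> = (\<Sum>j\<in>{0}. of_nat (p ^ e choose j) * of_nat (N choose (k - j)))"
    by (rule sum.mono_neutral_right) (use z in auto)
  finally show ?thesis by simp
qed

text \<open>A weak form of Lucas's theorem, obtained by induction on the quotient
  \<open>N div p ^ e\<close>.\<close>

lemma of_nat_choose_mod_prime_power:
  assumes "prime p" "CHAR('k::comm_semiring_1) = p" "k < p ^ e"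
  shows "(of_nat (N choose k) :: 'k) = of_nat ((N mod p ^ e) choose k)"
proof -
  have "(of_nat ((r + c * p ^ e) choose k) :: 'k) = of_nat (r choose k)" for r c
  proof (induction c)
    case (Suc c)
    then show ?case
      using of_nat_choose_add_prime_power[OF assms, of "r + c * p ^ e"] by (simp add: ac_simps)
  qed simp
  from this[of "N mod p ^ e" "N div p ^ e"] show ?thesis
    by (simp only: mod_div_mult_eq)
qed

subsection \<open>Monomials\<close>

abbreviation coef :: "('a \<Rightarrow>\<^sub>0 'b::zero) \<Rightarrow> 'a \<Rightarrow> 'b" where "coef \<equiv> Poly_Mapping.lookup"
abbreviation monomial :: "'a \<Rightarrow> 'b::zero \<Rightarrow> 'a \<Rightarrow>\<^sub>0 'b" where "monomial \<equiv> Poly_Mapping.single"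

definition exps :: "nat \<Rightarrow> (nat \<Rightarrow>\<^sub>0 nat) set" where
  "exps n = {m. Poly_Mapping.keys m \<subseteq> {..<n}}"

lemma exps_iff: "m \<in> exps n \<longleftrightarrow> (\<forall>i. n \<le> i \<longrightarrow> coef m i = 0)"
  by (auto simp: exps_def subset_eq in_keys_iff not_less[symmetric])

lemma exps_0 [simp, intro]: "0 \<in> exps n"
  and exps_add [simp, intro]: "a \<in> exps n \<Longrightarrow> b \<in> exps n \<Longrightarrow> a + b \<in> exps n"
  and exps_diff [simp, intro]: "a \<in> exps n \<Longrightarrow> a - b \<in> exps n"
  and exps_single: "i < n \<Longrightarrow> monomial i c \<in> exps n"
  by (auto simp: exps_iff lookup_add lookup_minus lookup_single when_def)

text \<open>For \<open>q > 0\<close> this is the top corner of \<open>cube n q\<close>, in which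
  \<open>a\<close> is paired with \<open>box n q - a\<close>.\<close>

definition box :: "nat \<Rightarrow> nat \<Rightarrow> nat \<Rightarrow>\<^sub>0 nat" where
  "box n q = (\<Sum>i<n. monomial i (q - 1))"

lemma lookup_box [simp]: "coef (box n q) i = (if i < n then q - Suc 0 else 0)"
  by (simp add: box_def lookup_sum lookup_single when_def)

lemma box_exps [simp, intro]: "box n q \<in> exps n"
  by (simp add: exps_iff)

text \<open>For \<open>q > 0\<close> this indexes the monomial basis over the subring generated by
  the constants and the \<open>x_i^q\<close>.\<close>

definition cube :: "nat \<Rightarrow> nat \<Rightarrow> (nat \<Rightarrow>\<^sub>0 nat) set" where
  "cube n q = {a \<in> exps n. \<forall>i<n. coef a i < q}"

lemma finite_cube [simp, intro]: "finite (cube n q)"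
proof (rule finite_imageD)
  have "finite {f :: nat \<Rightarrow> nat. \<forall>x. (x \<in> {..<n} \<longrightarrow> f x \<in> {..<q}) \<and> (x \<notin> {..<n} \<longrightarrow> f x = 0)}"
    by (rule finite_set_of_finite_funs) auto
  then show "finite (coef ` cube n q)"
    by (rule rev_finite_subset) (auto simp: cube_def exps_iff)
  show "inj_on coef (cube n q)"
    by (auto intro: inj_onI poly_mapping_eqI)
qed

text \<open>Splits \<open>x^m\<close> into a basis monomial and a monomial in the
  \<open>x_i^q\<close>. Using \<open>Poly_Mapping.map\<close> is safe because
  \<open>0 mod q = 0\<close>.\<close>

definition mod_exp :: "nat \<Rightarrow> (nat \<Rightarrow>\<^sub>0 nat) \<Rightarrow> nat \<Rightarrow>\<^sub>0 nat" where
  "mod_exp q m = Poly_Mapping.map (\<lambda>v. v mod q) m"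

lemma lookup_mod_exp [simp]: "coef (mod_exp q m) i = coef m i mod q"
  by (auto simp: mod_exp_def Poly_Mapping.map.rep_eq when_def)

lemma mod_exp_cube: "q > 0 \<Longrightarrow> m \<in> exps n \<Longrightarrow> mod_exp q m \<in> cube n q"
  by (auto simp: cube_def exps_iff)

section \<open>Polynomials in \<open>n\<close> variables and their coefficients\<close>

lemma mpoly_ring_carrier: "P \<in> carrier (mpoly_ring n) \<longleftrightarrow> Poly_Mapping.keys P \<subseteq> exps n"
  by (auto simp: mpoly_ring_def exps_def)

lemma mpoly_ring_carrier_coef:
  "P \<in> carrier (mpoly_ring n) \<longleftrightarrow> (\<forall>m. coef P m \<noteq> 0 \<longrightarrow> m \<in> exps n)"
  by (auto simp: mpoly_ring_carrier in_keys_iff)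

lemma single_in_carrier: "m \<in> exps n \<Longrightarrow> monomial m c \<in> carrier (mpoly_ring n)"
  by (auto simp: mpoly_ring_carrier)

lemma mpoly_ring_closed [simp, intro]:
  fixes P Q :: "(nat \<Rightarrow>\<^sub>0 nat) \<Rightarrow>\<^sub>0 'k::field"
  shows "P \<in> carrier (mpoly_ring n) \<Longrightarrow> Q \<in> carrier (mpoly_ring n) \<Longrightarrow> P + Q \<in> carrier (mpoly_ring n)"
    and "P \<in> carrier (mpoly_ring n) \<Longrightarrow> Q \<in> carrier (mpoly_ring n) \<Longrightarrow> P - Q \<in> carrier (mpoly_ring n)"
    and "P \<in> carrier (mpoly_ring n) \<Longrightarrow> - P \<in> carrier (mpoly_ring n)"
    and "P \<in> carrier (mpoly_ring n) \<Longrightarrow> Q \<in> carrier (mpoly_ring n) \<Longrightarrow> P * Q \<in> carrier (mpoly_ring n)"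
    and "0 \<in> carrier (mpoly_ring n :: ('k, _) module)" "1 \<in> carrier (mpoly_ring n :: ('k, _) module)"
    and "monomial 0 c \<in> carrier (mpoly_ring n :: ('k, _) module)"
proof -
  interpret algebra "ring_of_type_algebra :: 'k ring" "mpoly_ring n :: ('k, _) module"
    by (rule mpoly_ring_algebra)
  show "P + Q \<in> carrier (mpoly_ring n)" if "P \<in> carrier (mpoly_ring n)" "Q \<in> carrier (mpoly_ring n)"
    using M.add.m_closed[OF that] by simp
  show "P * Q \<in> carrier (mpoly_ring n)" if "P \<in> carrier (mpoly_ring n)" "Q \<in> carrier (mpoly_ring n)"
    using m_closed[OF that] by simp
  show "P - Q \<in> carrier (mpoly_ring n)" if "P \<in> carrier (mpoly_ring n)" "Q \<in> carrier (mpoly_ring n)"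
    unfolding mpoly_ring_carrier_coef
  proof (intro allI impI)
    fix m assume "coef (P - Q) m \<noteq> 0"
    then have "coef P m \<noteq> 0 \<or> coef Q m \<noteq> 0" by (auto simp: lookup_minus)
    then show "m \<in> exps n" using that by (auto simp: mpoly_ring_carrier_coef)
  qed
  show "- P \<in> carrier (mpoly_ring n)" if "P \<in> carrier (mpoly_ring n)"
    using that by (force simp: mpoly_ring_carrier_coef)
  show "0 \<in> carrier (mpoly_ring n :: ('k, _) module)" using M.zero_closed by simp
  show "1 \<in> carrier (mpoly_ring n :: ('k, _) module)" using one_closed by simp
  show "monomial 0 c \<in> carrier (mpoly_ring n :: ('k, _) module)" by (simp add: single_in_carrier)
qed

lemma sum_in_carrier:
  fixes u :: "'a \<Rightarrow> (nat \<Rightarrow>\<^sub>0 nat) \<Rightarrow>\<^sub>0 'k::field"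
  assumes "\<And>a. a \<in> A \<Longrightarrow> u a \<in> carrier (mpoly_ring n)"
  shows "sum u A \<in> carrier (mpoly_ring n)"
  using assms by (induction A rule: infinite_finite_induct) auto

lemma mpoly_sum_monoms:
  fixes P :: "'a \<Rightarrow>\<^sub>0 'b::comm_monoid_add"
  shows "P = (\<Sum>m\<in>Poly_Mapping.keys P. monomial m (coef P m))"
proof (rule poly_mapping_eqI)
  fix t show "coef P t = coef (\<Sum>m\<in>Poly_Mapping.keys P. monomial m (coef P m)) t"
    by (cases "t \<in> Poly_Mapping.keys P")
      (auto simp: lookup_sum lookup_single when_def in_keys_iff)
qed

lemma mpoly_ring_induct [consumes 1, case_names monomial add]:
  fixes P :: "(nat \<Rightarrow>\<^sub>0 nat) \<Rightarrow>\<^sub>0 'k::field"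
  assumes P: "P \<in> carrier (mpoly_ring n)"
    and monomial: "\<And>m c. m \<in> exps n \<Longrightarrow> Q (monomial m c)"
    and add: "\<And>F G. F \<in> carrier (mpoly_ring n) \<Longrightarrow> G \<in> carrier (mpoly_ring n) \<Longrightarrow>
      Q F \<Longrightarrow> Q G \<Longrightarrow> Q (F + G)"
  shows "Q P"
proof -
  have "Q (\<Sum>m\<in>A. monomial m (coef P m))" if "finite A" "A \<subseteq> exps n" for A
    using that
  proof (induction A)
    case empty
    then show ?case using monomial[of 0 0] by simp
  next
    case (insert m A)
    then show ?case
      by (auto intro!: add monomial single_in_carrier sum_in_carrier)
  qed
  from this[of "Poly_Mapping.keys P"] P show ?thesis
    by (subst mpoly_sum_monoms) (auto simp: mpoly_ring_carrier)
qed

lemma coef_monom_mult: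
  fixes P :: "(nat \<Rightarrow>\<^sub>0 nat) \<Rightarrow>\<^sub>0 'k::field"
  shows "coef (monomial a c * P) t = (if \<forall>i. coef a i \<le> coef t i then c * coef P (t - a) else 0)"
proof -
  have lin: "?thesis" if "P = (\<Sum>m\<in>A. monomial m (f m))" "finite A" for A f
    using that(2,1)
  proof (induction A arbitrary: P)
    case empty
    then show ?case by simp
  next
    case (insert m A)
    \<comment> \<open>Subtraction of exponents is truncated, so it inverts addition only under the
      componentwise bound.\<close>
    have "(a + m = t) \<longleftrightarrow> (\<forall>i. coef a i \<le> coef t i) \<and> m = t - a"
    proof
      assume "a + m = t"
      then show "(\<forall>i. coef a i \<le> coef t i) \<and> m = t - a"
        by (auto simp: lookup_add)
    next
      assume "(\<forall>i. coef a i \<le> coef t i) \<and> m = t - a"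
      then show "a + m = t"
        by (auto intro!: poly_mapping_eqI simp: lookup_add lookup_minus)
    qed
    then show ?case
      using insert by (auto simp: distrib_left lookup_add mult_single lookup_single when_def
          algebra_simps)
  qed
  show ?thesis by (rule lin[OF mpoly_sum_monoms]) simp
qed

lemma coef_monom_single_mult:
  fixes P :: "(nat \<Rightarrow>\<^sub>0 nat) \<Rightarrow>\<^sub>0 'k::field"
  shows "coef (monomial (monomial i c) d * P) t = (if c \<le> coef t i then d * coef P (t - monomial i c) else 0)"
proof -
  have "(\<forall>j. coef (monomial i c) j \<le> coef t j) \<longleftrightarrow> c \<le> coef t i"
    by (auto simp: lookup_single when_def)
  then show ?thesis by (simp add: coef_monom_mult)
qed

subsection \<open>Divided power derivatives\<close>

definition mbinom :: "nat \<Rightarrow> (nat \<Rightarrow>\<^sub>0 nat) \<Rightarrow> (nat \<Rightarrow>\<^sub>0 nat) \<Rightarrow> nat" where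
  "mbinom n m a = (\<Prod>i<n. coef m i choose coef a i)"

text \<open>For \<open>a\<close> in \<open>exps n\<close> this sends \<open>x^m\<close> to the
  multinomial factor \<open>mbinom n m a\<close> times \<open>x^(m - a)\<close>; in characteristic
  zero it is the iterated derivative divided by the factorials. Describing it by coefficients avoids
  both division and truncated subtraction.\<close>

definition dpd :: "nat \<Rightarrow> (nat \<Rightarrow>\<^sub>0 nat) \<Rightarrow> ((nat \<Rightarrow>\<^sub>0 nat) \<Rightarrow>\<^sub>0 'k::field) \<Rightarrow> (nat \<Rightarrow>\<^sub>0 nat) \<Rightarrow>\<^sub>0 'k" where
  "dpd n a P = Abs_poly_mapping (\<lambda>t. of_nat (mbinom n (t + a) a) * coef P (t + a))"

lemma coef_dpd: "coef (dpd n a P) t = of_nat (mbinom n (t + a) a) * coef P (t + a)"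
proof -
  \<comment> \<open>Translation by \<open>a\<close> is injective, so the new support lies in a
    finite preimage.\<close>
  have "finite ((\<lambda>t. t + a) -` Poly_Mapping.keys P)"
    by (rule finite_vimageI) (auto simp: inj_on_def)
  then have "finite {t. of_nat (mbinom n (t + a) a) * coef P (t + a) \<noteq> 0}"
    by (rule rev_finite_subset) (auto simp: in_keys_iff)
  then show ?thesis by (simp add: dpd_def)
qed

lemma dpd_in_carrier: 
  assumes "P \<in> carrier (mpoly_ring n)" shows "dpd n a P \<in> carrier (mpoly_ring n)"
  unfolding mpoly_ring_carrier_coef
proof (intro allI impI)
  fix m assume "coef (dpd n a P) m \<noteq> 0"
  then have "m + a \<in> exps n" using assms by (auto simp: coef_dpd mpoly_ring_carrier_coef)
  then show "m \<in> exps n" by (simp add: exps_iff lookup_add)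
qed

lemma dpd_add: "dpd n a (P + Q) = dpd n a P + dpd n a Q"
  by (rule poly_mapping_eqI) (simp add: coef_dpd lookup_add algebra_simps)

lemma dpd_smult: "dpd n a (monomial 0 c * P) = monomial 0 c * dpd n a P"
  by (rule poly_mapping_eqI) (simp add: coef_dpd coef_monom_mult mult.left_commute)

lemma dpd_0: "dpd n 0 P = P"
  by (rule poly_mapping_eqI) (simp add: coef_dpd mbinom_def)

lemma mbinom_pascal:
  assumes "i < n"
  shows "mbinom n (m + monomial i 1) (a + monomial i 1) = mbinom n m a + mbinom n m (a + monomial i 1)"
proof -
  have *: "mbinom n u v = (coef u i choose coef v i) * (\<Prod>j\<in>{..<n}-{i}. coef u j choose coef v j)" for u v
    unfolding mbinom_def using assms by (subst prod.remove[of _ i]) auto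
  have "(\<Prod>j\<in>{..<n}-{i}. coef (m + monomial i 1) j choose coef (a + monomial i 1) j)
      = (\<Prod>j\<in>{..<n}-{i}. coef m j choose coef a j)"
    "(\<Prod>j\<in>{..<n}-{i}. coef m j choose coef (a + monomial i 1) j)
      = (\<Prod>j\<in>{..<n}-{i}. coef m j choose coef a j)"
    by (auto intro!: prod.cong simp: lookup_add lookup_single when_def)
  then show ?thesis unfolding * by (simp add: lookup_add algebra_simps)
qed

text \<open>Pascal's rule in coordinate \<open>i\<close>, read off coefficient by
  coefficient.\<close>

lemma dpd_commutator:
  assumes "i < n"
  shows "dpd n (a + monomial i 1) (monomial (monomial i 1) 1 * P) - monomial (monomial i 1) 1 * dpd n (a + monomial i 1) P
    = dpd n a P"
proof (rule poly_mapping_eqI)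
  fix t
  let ?e = "monomial i 1 :: nat \<Rightarrow>\<^sub>0 nat"
  have A: "coef (dpd n (a + ?e) (monomial ?e 1 * P)) t
      = of_nat (mbinom n (t + a + ?e) (a + ?e)) * coef P (t + a)"
    by (simp add: coef_dpd coef_monom_single_mult lookup_add flip: add.assoc)
  have B: "coef (monomial ?e 1 * dpd n (a + ?e) P) t
      = of_nat (mbinom n (t + a) (a + ?e)) * coef P (t + a)"
  proof (cases "coef t i = 0")
    case True
    \<comment> \<open>When \<open>t_i = 0\<close>, the factor at \<open>i\<close> is
      \<open>a_i choose (a_i + 1)\<close>; this matches the missing coefficient in a multiple of
      \<open>x_i\<close>.\<close>
    have "mbinom n (t + a) (a + ?e) = 0"
      unfolding mbinom_def using True assms
      by (auto simp: lookup_add lookup_single intro!: bexI[of _ i])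
    then show ?thesis using True by (simp add: coef_monom_single_mult)
  next
    case False
    then have "t - ?e + (a + ?e) = t + a"
      by (auto intro!: poly_mapping_eqI simp: lookup_add lookup_minus lookup_single when_def)
    then show ?thesis using False by (simp add: coef_monom_single_mult coef_dpd)
  qed
  show "coef (dpd n (a + ?e) (monomial ?e 1 * P) - monomial ?e 1 * dpd n (a + ?e) P) t = coef (dpd n a P) t"
    unfolding lookup_minus A B using mbinom_pascal[OF assms, of "t + a" a]
    by (simp add: coef_dpd algebra_simps)
qed

lemma dpd_commute:
  assumes "i < n" "coef a i = 0"
  shows "dpd n a (monomial (monomial i 1) 1 * P) = monomial (monomial i 1) 1 * dpd n a P"
proof (rule poly_mapping_eqI)
  fix t
  let ?e = "monomial i 1 :: nat \<Rightarrow>\<^sub>0 nat"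
  have 2: "t - ?e + a = t + a - ?e" if "1 \<le> coef t i"
    using that by (auto intro!: poly_mapping_eqI simp: lookup_add lookup_minus lookup_single when_def)
  have "mbinom n (t + a) a = mbinom n (t + a - ?e) a"
    unfolding mbinom_def
    by (intro prod.cong refl) (auto simp: lookup_minus lookup_single when_def assms)
  then show "coef (dpd n a (monomial ?e 1 * P)) t = coef (monomial ?e 1 * dpd n a P) t"
    using assms by (auto simp: coef_dpd coef_monom_single_mult 2 lookup_add simp del: One_nat_def)
qed

lemma exponent_less_add:
  fixes a :: "nat \<Rightarrow>\<^sub>0 nat"
  assumes "a \<noteq> 0" shows "m < m + a"
proof -
  have "\<not> a < 0"
    by transfer (auto simp: less_fun_def)
  with assms have "0 < a" by simp
  then have "m + 0 < m + a" by (rule add_strict_left_mono)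
  then show ?thesis by simp
qed

text \<open>Leading monomials with respect to the lexicographic order: \<open>dpd n a\<close> lowers them, while
  multiplication by \<open>g\<close> does not.\<close>

lemma dpd_plus_mult_nonzero:
  assumes "a \<noteq> 0" "g \<noteq> 0" "P \<noteq> 0"
  shows "monomial 0 c * dpd n a P + g * P \<noteq> 0"
proof -
  define u v where "u = Max (Poly_Mapping.keys g)" and "v = Max (Poly_Mapping.keys P)"
  have u: "u \<in> Poly_Mapping.keys g" and v: "v \<in> Poly_Mapping.keys P"
    using assms by (auto simp: u_def v_def)
  have u': "x \<le> u" if "x \<in> Poly_Mapping.keys g" for x using that by (simp add: u_def)
  have v': "x \<le> v" if "x \<in> Poly_Mapping.keys P" for x using that by (simp add: v_def)
  have u0: "u \<ge> 0"
    by (cases "u = 0") (use exponent_less_add[of u 0] in auto)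
  \<comment> \<open>This coefficient is a multiple of the one of \<open>P\<close> at
    \<open>u + v + a\<close>, beyond the leading exponent \<open>v\<close>.\<close>
  have "coef (dpd n a P) (u + v) = 0"
  proof -
    have "v < u + v + a"
      using exponent_less_add[OF assms(1), of "u + v"] add_right_mono[OF u0, of v] by simp
    then have "u + v + a \<notin> Poly_Mapping.keys P" using v' by force
    then show ?thesis by (simp add: coef_dpd in_keys_iff)
  qed
  moreover have "coef (g * P) (u + v) = coef g u * coef P v"
  proof -
    \<comment> \<open>Split off the leading term of \<open>g\<close>: the rest has all exponents
      below \<open>u\<close> and cannot contribute at \<open>u + v\<close>.\<close>
    define g' where "g' = g - monomial u (coef g u)"
    have g': "x < u" if "x \<in> Poly_Mapping.keys g'" for x
    proof -
      have "x \<noteq> u" "x \<in> Poly_Mapping.keys g"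
        using that by (auto simp: g'_def in_keys_iff lookup_minus lookup_single when_def split: if_splits)
      with u' show ?thesis by force
    qed
    have "u + v \<notin> Poly_Mapping.keys (g' * P)"
    proof
      assume "u + v \<in> Poly_Mapping.keys (g' * P)"
      then obtain x y where "x \<in> Poly_Mapping.keys g'" "y \<in> Poly_Mapping.keys P" "u + v = x + y"
        using keys_mult[of g' P] by blast
      with add_less_le_mono[OF g' v', of x y] show False by simp
    qed
    moreover have "g * P = monomial u (coef g u) * P + g' * P"
      by (simp add: g'_def algebra_simps)
    ultimately show ?thesis
      by (simp add: lookup_add in_keys_iff coef_monom_mult)
  qed
  ultimately have "coef (monomial 0 c * dpd n a P + g * P) (u + v) \<noteq> 0"
    using u v by (simp add: lookup_add coef_monom_mult in_keys_iff)
  then show ?thesis by auto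
qed

subsection \<open>The trace\<close>

abbreviation tr :: "nat \<Rightarrow> nat \<Rightarrow> ((nat \<Rightarrow>\<^sub>0 nat) \<Rightarrow>\<^sub>0 'k::field) \<Rightarrow> (nat \<Rightarrow>\<^sub>0 nat) \<Rightarrow>\<^sub>0 'k" where
  "tr n q \<equiv> dpd n (box n q)"

text \<open>Exponents congruent to \<open>-1\<close> modulo \<open>q\<close> in each of the
  \<open>n\<close> coordinates; when \<open>q\<close> is a power of the characteristic, exactly
  these monomials have nonzero trace.\<close>

definition corner :: "nat \<Rightarrow> nat \<Rightarrow> (nat \<Rightarrow>\<^sub>0 nat) \<Rightarrow> bool" where
  "corner n q m \<longleftrightarrow> (\<forall>i<n. q dvd Suc (coef m i))"

text \<open>Modulo \<open>p\<close> the factor \<open>N choose (q - 1)\<close> depends only on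
  \<open>r = N mod q\<close>, and \<open>r choose (q - 1)\<close> vanishes unless
  \<open>r = q - 1\<close>.\<close>

lemma of_nat_mbinom_box:
  assumes "prime p" "CHAR('k::field) = p" and q: "q = p ^ e"
  shows "(of_nat (mbinom n m (box n q)) :: 'k) = (if corner n q m then 1 else 0)"
proof -
  have q0: "q > 0" using assms by (simp add: prime_gt_0_nat)
  have *: "(of_nat (N choose (q - Suc 0)) :: 'k) = (if q dvd Suc N then 1 else 0)" for N
  proof -
    have "(of_nat (N choose (q - Suc 0)) :: 'k) = of_nat ((N mod q) choose (q - Suc 0))"
      using of_nat_choose_mod_prime_power[OF assms(1,2), of "q - Suc 0" e N] q q0 by simp
    also have "\<dots> = (if N mod q = q - Suc 0 then 1 else 0)"
      using q0 mod_less_divisor[OF q0, of N] by (auto simp: binomial_eq_0)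
    also have "N mod q = q - Suc 0 \<longleftrightarrow> q dvd Suc N"
      using q0 by (auto simp: dvd_eq_mod_eq_0 mod_Suc split: if_splits)
    finally show ?thesis .
  qed
  have "(of_nat (mbinom n m (box n q)) :: 'k) = (\<Prod>i<n. if q dvd Suc (coef m i) then 1 else 0)"
    unfolding mbinom_def of_nat_prod by (intro prod.cong) (auto simp: *)
  also have "\<dots> = (if corner n q m then 1 else 0)"
    by (auto simp: corner_def)
  finally show ?thesis .
qed

lemma tr_monom:
  assumes "prime p" "CHAR('k::field) = p" and q: "q = p ^ e"
  shows "tr n q (monomial m (c::'k)) = (if corner n q m then monomial (m - box n q) c else 0)"
proof (rule poly_mapping_eqI)
  fix t
  \<comment> \<open>At a corner every coordinate below \<open>n\<close> is at least
    \<open>q - 1\<close>, so the truncated subtraction loses nothing.\<close>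
  have "(m = t + box n q) \<longleftrightarrow> (m - box n q = t)" if "corner n q m"
  proof -
    have "coef (box n q) i \<le> coef m i" for i
    proof (cases "i < n")
      case True
      then have "q dvd Suc (coef m i)" using that by (simp add: corner_def)
      then have "q \<le> Suc (coef m i)" by (rule dvd_imp_le) simp
      then show ?thesis using True by simp
    qed simp
    then have "m - box n q + box n q = m"
      by (auto intro!: poly_mapping_eqI simp: lookup_add lookup_minus simp del: lookup_box)
    then show ?thesis by auto
  qed
  then show "coef (tr n q (monomial m c)) t
      = coef (if corner n q m then monomial (m - box n q) c else 0) t"
    by (auto simp: coef_dpd of_nat_mbinom_box[OF assms] lookup_single when_def)
qed

text \<open>Only exponents \<open>t\<close> with \<open>q\<close> dividing \<open>t_i\<close> can
  survive the trace. There the derivative contributes the factor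
  \<open>(t_i + q - 1 + a_i) choose a_i\<close>, which modulo \<open>p\<close> equals
  \<open>(a_i - 1) choose a_i = 0\<close>.\<close>

lemma tr_dpd:
  assumes "prime p" "CHAR('k::field) = p" and q: "q = p ^ e" and "i < n" "0 < coef a i" "coef a i < q"
  shows "tr n q (dpd n a (P :: _ \<Rightarrow>\<^sub>0 'k)) = 0"
proof (rule poly_mapping_eqI)
  fix t
  let ?b = "box n q"
  have "(of_nat (mbinom n (t + ?b + a) a) :: 'k) = 0" if "corner n q (t + ?b)"
  proof -
    have "q dvd Suc (coef t i + (q - 1))" using that \<open>i < n\<close> by (simp add: corner_def lookup_add)
    moreover have "Suc (coef t i + (q - 1)) = coef t i + q" using assms(6) by simp
    ultimately have "q dvd coef t i" by (metis dvd_add_triv_right_iff)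
    then obtain c where c: "coef t i = q * c" by (rule dvdE)
    have "(of_nat ((q * c + (q - 1) + coef a i) choose coef a i) :: 'k)
       = of_nat (((q * c + (q - 1) + coef a i) mod q) choose coef a i)"
      unfolding q by (rule of_nat_choose_mod_prime_power[OF assms(1,2)]) (use assms(6) q in simp)
    also have "(q * c + (q - 1) + coef a i) mod q = coef a i - 1"
    proof -
      have "q * c + (q - 1) + coef a i = coef a i - 1 + q * (c + 1)" using assms(5,6) by simp
      then have "(q * c + (q - 1) + coef a i) mod q = (coef a i - 1) mod q" by (simp only: mod_mult_self2)
      then show ?thesis using assms(6) by simp
    qed
    also have "(coef a i - 1) choose coef a i = 0" using assms(5) by (simp add: binomial_eq_0)
    finally have "(of_nat ((coef (t + ?b + a) i) choose coef a i) :: 'k) = 0"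
      using \<open>i < n\<close> by (simp add: lookup_add c)
    then show ?thesis
      unfolding mbinom_def of_nat_prod using \<open>i < n\<close> by (intro prod_zero) auto
  qed
  then show "coef (tr n q (dpd n a P)) t = coef 0 t"
    by (auto simp: coef_dpd of_nat_mbinom_box[OF assms(1,2,3)])
qed

text \<open>
  This is \<open>x\<^sub>0 ^ (q - 1) \<cdots> x\<^bsub>n-1\<^esub> ^ (q - 1) * tr n q P\<close>. Unlike the trace itself, these projections absorb
  one another when \<open>q\<close> grows, so adjoints for different \<open>q\<close> can be compared directly.
\<close>

definition corner_part :: "nat \<Rightarrow> nat \<Rightarrow> ((nat \<Rightarrow>\<^sub>0 nat) \<Rightarrow>\<^sub>0 'k::field) \<Rightarrow> (nat \<Rightarrow>\<^sub>0 nat) \<Rightarrow>\<^sub>0 'k" where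
  "corner_part n q P = Abs_poly_mapping (\<lambda>t. if corner n q t then coef P t else 0)"

lemma coef_corner_part: "coef (corner_part n q P) t = (if corner n q t then coef P t else 0)"
proof -
  have "finite {t. (if corner n q t then coef P t else 0) \<noteq> 0}"
    by (rule rev_finite_subset[OF finite_keys[of P]]) (auto simp: in_keys_iff)
  then show ?thesis by (simp add: corner_part_def)
qed

lemma corner_part_add: "corner_part n q (P + Q) = corner_part n q P + corner_part n q Q"
  by (rule poly_mapping_eqI) (simp add: coef_corner_part lookup_add)

lemma corner_part_0 [simp]: "corner_part n q 0 = 0"
  by (rule poly_mapping_eqI) (simp add: coef_corner_part)

lemma corner_part_sum: "corner_part n q (sum f A) = (\<Sum>a\<in>A. corner_part n q (f a))"
  by (induction A rule: infinite_finite_induct) (auto simp: corner_part_add)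

lemma corner_part_monom: "corner_part n q (monomial m c) = (if corner n q m then monomial m c else 0)"
  by (rule poly_mapping_eqI) (auto simp: coef_corner_part lookup_single when_def)

text \<open>Every corner for \<open>q'\<close> is a corner for \<open>q\<close>. This is the
  compatibility of the forms for different \<open>q\<close>.\<close>

lemma corner_part_corner_part:
  "q dvd q' \<Longrightarrow> corner_part n q' (corner_part n q P) = corner_part n q' P"
  by (rule poly_mapping_eqI) (auto simp: coef_corner_part corner_def intro: dvd_trans)

text \<open>A suitable monomial factor moves any given exponent to a corner, so every coefficient of
  \<open>h\<close> is detected by some product.\<close>

lemma corner_part_nondegenerate:
  assumes h: "h \<in> carrier (mpoly_ring n)" and "q > 0"
    and 0: "\<And>f. f \<in> carrier (mpoly_ring n) \<Longrightarrow> corner_part n q (f * h) = 0"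
  shows "h = 0"
proof (rule poly_mapping_eqI)
  fix m
  \<comment> \<open>Adding \<open>a\<close> raises each coordinate of \<open>m\<close> to the next
    number congruent to \<open>-1\<close> modulo \<open>q\<close>.\<close>
  define a where "a = box n q - mod_exp q m"
  have "a \<in> exps n" by (simp add: a_def)
  then have "coef (corner_part n q (monomial a 1 * h)) (a + m) = 0"
    using 0[OF single_in_carrier] by simp
  moreover have "corner n q (a + m)"
    unfolding corner_def
  proof (intro allI impI)
    fix i assume "i < n"
    have *: "r < q \<Longrightarrow> Suc (q - Suc r + (r + q * c)) = q * (c + 1)" for r c by simp
    have "Suc (coef (a + m) i) = q * (coef m i div q + 1)"
      using \<open>i < n\<close> *[of "coef m i mod q" "coef m i div q"] \<open>q > 0\<close>
      by (simp add: a_def lookup_add lookup_minus)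
    then show "q dvd Suc (coef (a + m) i)" by simp
  qed
  ultimately show "coef h m = coef 0 m"
    by (simp add: coef_corner_part coef_monom_mult lookup_add)
qed

text \<open>Monomials carry arbitrary coefficients here, so additivity in each argument reduces an
  identity to them.\<close>

lemma mpoly_bilinear_eq:
  fixes B B' :: "((nat \<Rightarrow>\<^sub>0 nat) \<Rightarrow>\<^sub>0 'k::field) \<Rightarrow> ((nat \<Rightarrow>\<^sub>0 nat) \<Rightarrow>\<^sub>0 'k) \<Rightarrow> ((nat \<Rightarrow>\<^sub>0 nat) \<Rightarrow>\<^sub>0 'k)"
  assumes "P \<in> carrier (mpoly_ring n)" "Q \<in> carrier (mpoly_ring n)"
    and "\<And>F G H. B (F + G) H = B F H + B G H" "\<And>F G H. B H (F + G) = B H F + B H G"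
    and "\<And>F G H. B' (F + G) H = B' F H + B' G H" "\<And>F G H. B' H (F + G) = B' H F + B' H G"
    and "\<And>m m' c c'. m \<in> exps n \<Longrightarrow> m' \<in> exps n \<Longrightarrow> B (monomial m c) (monomial m' c') = B' (monomial m c) (monomial m' c')"
  shows "B P Q = B' P Q"
proof -
  have "B (monomial m c) Q = B' (monomial m c) Q" if "m \<in> exps n" for m c
    using assms(2) by (induction rule: mpoly_ring_induct) (simp_all add: assms that)
  with assms(1) show ?thesis
    by (induction rule: mpoly_ring_induct) (simp_all add: assms)
qed

text \<open>On monomials \<open>x^a\<close> and \<open>x^b\<close> both sides vanish unless
  \<open>a\<close> and \<open>b\<close> are corners; then \<open>box n q\<close> may be subtracted
  from either exponent.\<close>

lemma tr_self_adjoint: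
  assumes "prime p" "CHAR('k::field) = p" and q: "q = p ^ e"
    and "P \<in> carrier (mpoly_ring n)" "Q \<in> carrier (mpoly_ring n)"
  shows "corner_part n q (tr n q P * Q) = corner_part n q (P * tr n q (Q :: _ \<Rightarrow>\<^sub>0 'k))"
proof -
  let ?b = "box n q"
  have q0: "q > 0" using assms by (simp add: prime_gt_0_nat)
  have *: "corner n q (a - ?b + b) \<longleftrightarrow> corner n q b" if "corner n q a" for a b
  proof -
    have "q dvd Suc (coef (a - ?b + b) i) \<longleftrightarrow> q dvd Suc (coef b i)" if "i < n" for i
    proof -
      have "q dvd Suc (coef a i)" using \<open>corner n q a\<close> that by (simp add: corner_def)
      then obtain c where c: "Suc (coef a i) = q * c" by auto
      then obtain c' where "c = Suc c'" by (cases c) auto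
      with c q0 have "coef a i - (q - 1) = q * c'" by simp
      then have "Suc (coef (a - ?b + b) i) = q * c' + Suc (coef b i)"
        using that by (simp add: lookup_add lookup_minus)
      then show ?thesis by (metis dvd_add_right_iff dvd_triv_left)
    qed
    then show ?thesis by (simp add: corner_def)
  qed
  have **: "a - ?b + b = a + (b - ?b)" if "corner n q a" "corner n q b" for a b
  proof (rule poly_mapping_eqI)
    fix i
    have "q \<le> Suc (coef a i)" "q \<le> Suc (coef b i)" if "i < n"
      using \<open>corner n q a\<close> \<open>corner n q b\<close> that by (auto simp: corner_def intro: dvd_imp_le)
    then show "coef (a - ?b + b) i = coef (a + (b - ?b)) i"
      by (auto simp: lookup_add lookup_minus)
  qed
  show ?thesis
    using assms(4,5)
  proof (rule mpoly_bilinear_eq)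
    fix a b :: "nat \<Rightarrow>\<^sub>0 nat" and c d :: 'k
    show "corner_part n q (tr n q (monomial a c) * monomial b d) = corner_part n q (monomial a c * tr n q (monomial b d))"
      using *[of a b] *[of b a] **[of a b]
      by (auto simp: tr_monom[OF assms(1-3)] mult_single corner_part_monom add.commute)
  qed (simp_all add: dpd_add corner_part_add algebra_simps)
qed

text \<open>Duality of the bases \<open>x^a\<close> and \<open>x^(box - a)\<close>: the exponent
  \<open>box n q - a + m\<close> is a corner exactly when \<open>a\<close> is the remainder of
  \<open>m\<close> modulo \<open>q\<close>, and the trace leaves the \<open>q\<close>-divisible
  part.\<close>

lemma tr_dual_monom:
  assumes "prime p" "CHAR('k::field) = p" and q: "q = p ^ e" and m: "m \<in> exps n" and a: "a \<in> cube n q"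
  shows "tr n q (monomial (box n q - a) 1 * monomial m (1::'k))
    = (if a = mod_exp q m then monomial (m - mod_exp q m) 1 else 0)"
proof -
  let ?b = "box n q"
  have q0: "q > 0" using assms by (simp add: prime_gt_0_nat)
  have ai: "coef a i < q" if "i < n" for i using a that by (simp add: cube_def)
  have "corner n q (?b - a + m) \<longleftrightarrow> a = mod_exp q m"
  proof
    assume c: "corner n q (?b - a + m)"
    show "a = mod_exp q m"
    proof (rule poly_mapping_eqI)
      fix i
      show "coef a i = coef (mod_exp q m) i"
      proof (cases "i < n")
        case True
        then have "q dvd Suc (coef (?b - a + m) i)" using c by (simp add: corner_def)
        then obtain c where "Suc (q - 1 - coef a i + coef m i) = q * c"
          using True by (auto simp: lookup_add lookup_minus)
        then have "coef m i + q = coef a i + q * c" using ai[OF True] by simp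
        then have "(coef m i + q) mod q = (coef a i + q * c) mod q" by simp
        then show ?thesis using ai[OF True] by simp
      next
        case False
        then show ?thesis using a m by (simp add: cube_def exps_iff)
      qed
    qed
  next
    assume "a = mod_exp q m"
    have *: "r < q \<Longrightarrow> Suc (q - Suc r + (r + q * c)) = q * (c + 1)" for r c by simp
    have "Suc (coef (?b - a + m) i) = q * (coef m i div q + 1)" if "i < n" for i
      using that *[of "coef m i mod q" "coef m i div q"] q0 \<open>a = _\<close>
      by (simp add: lookup_add lookup_minus)
    then show "corner n q (?b - a + m)" by (simp add: corner_def)
  qed
  moreover have "?b - a + m - ?b = m - a" if "a = mod_exp q m"
  proof (rule poly_mapping_eqI)
    fix i
    show "coef (?b - a + m - ?b) i = coef (m - a) i"
      using ai[of i] m that by (auto simp: lookup_add lookup_minus exps_iff)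
  qed
  ultimately show ?thesis
    by (auto simp: mult_single tr_monom[OF assms(1-3)])
qed

subsection \<open>Differential operators on polynomial rings\<close>

type_synonym 'k mpol = "(nat \<Rightarrow>\<^sub>0 nat) \<Rightarrow>\<^sub>0 'k"

abbreviation Pol :: "nat \<Rightarrow> 'k::field mpol set" where
  "Pol n \<equiv> carrier (mpoly_ring n)"

abbreviation var :: "nat \<Rightarrow> 'k::field mpol" where
  "var i \<equiv> monomial (monomial i 1) 1"

abbreviation endos :: "nat \<Rightarrow> ('k::field mpol \<Rightarrow> 'k mpol) set" where
  "endos n \<equiv> linear_endos (ring_of_type_algebra :: 'k ring) (mpoly_ring n)"

abbreviation dops :: "nat \<Rightarrow> nat \<Rightarrow> ('k::field mpol \<Rightarrow> 'k mpol) set" where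
  "dops n m \<equiv> diff_ops_le (ring_of_type_algebra :: 'k ring) (mpoly_ring n) m"

definition all_dops :: "nat \<Rightarrow> ('k::field mpol \<Rightarrow> 'k mpol) set" where
  "all_dops n = (\<Union>m. dops n m)"

lemma all_dopsI: "\<xi> \<in> dops n m \<Longrightarrow> \<xi> \<in> all_dops n"
  by (auto simp: all_dops_def)

text \<open>The commutator \<open>[\<xi>, f]\<close> in pointwise form;
  \<open>commutator_mult_op\<close> identifies it with the one in \<open>End_ring\<close>.\<close>

definition comm_mult :: "nat \<Rightarrow> ('k::field mpol \<Rightarrow> 'k mpol) \<Rightarrow> 'k mpol \<Rightarrow> 'k mpol \<Rightarrow> 'k mpol" where
  "comm_mult n \<xi> f = (\<lambda>x\<in>Pol n. \<xi> (f * x) - f * \<xi> x)"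

text \<open>Induction on the total degree, removing one variable at a time.\<close>

lemma exps_induct [consumes 1, case_names zero add]:
  assumes "m \<in> exps n" "Q 0"
    and "\<And>i m. i < n \<Longrightarrow> m \<in> exps n \<Longrightarrow> Q m \<Longrightarrow> Q (m + monomial i 1)"
  shows "Q m"
  using assms(1)
proof (induction "\<Sum>i<n. coef m i" arbitrary: m)
  case 0
  then have "m = 0" by (intro poly_mapping_eqI) (auto simp: exps_iff not_less[symmetric])
  with assms show ?case by simp
next
  case (Suc d)
  have "\<exists>i\<in>{..<n}. coef m i \<noteq> 0"
  proof (rule ccontr)
    assume "\<not> (\<exists>i\<in>{..<n}. coef m i \<noteq> 0)"
    then have "(\<Sum>i<n. coef m i) = 0" by simp
    with Suc.hyps show False by simp
  qed
  then obtain i where i: "i < n" "coef m i \<noteq> 0" by blast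
  have m: "m - monomial i 1 + monomial i 1 = m"
    using i by (auto intro!: poly_mapping_eqI simp: lookup_add lookup_minus lookup_single when_def)
  have "(\<Sum>j<n. coef m j) = (\<Sum>j<n. coef (m - monomial i 1) j) + (\<Sum>j<n. coef (monomial i (1::nat)) j)"
    by (subst m[symmetric]) (simp add: lookup_add sum.distrib)
  also have "(\<Sum>j<n. coef (monomial i (1::nat)) j) = 1"
    using i by (simp add: lookup_single when_def)
  finally have "Q (m - monomial i 1)" using Suc by auto
  then show ?case using assms(3)[of i "m - monomial i 1"] i Suc m by simp
qed

lemma endosI:
  assumes "\<xi> \<in> extensional (Pol n)"
    and "\<And>x. x \<in> Pol n \<Longrightarrow> \<xi> x \<in> Pol n"
    and "\<And>x y. x \<in> Pol n \<Longrightarrow> y \<in> Pol n \<Longrightarrow> \<xi> (x + y) = \<xi> x + \<xi> y"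
    and "\<And>c x. x \<in> Pol n \<Longrightarrow> \<xi> (monomial 0 c * x) = monomial 0 c * \<xi> x"
  shows "\<xi> \<in> endos n"
  using assms by (intro linear_endosI) simp_all

lemma endosD:
  assumes "\<xi> \<in> endos n"
  shows "\<xi> \<in> extensional (Pol n)"
    and "x \<in> Pol n \<Longrightarrow> \<xi> x \<in> Pol n"
    and "x \<in> Pol n \<Longrightarrow> y \<in> Pol n \<Longrightarrow> \<xi> (x + y) = \<xi> x + \<xi> y"
    and "x \<in> Pol n \<Longrightarrow> \<xi> (monomial 0 c * x) = monomial 0 c * \<xi> x"
  using linear_endosD[OF assms] by (auto simp: ring_of_type_algebra_def)

lemma mult_op_endos: "f \<in> Pol n \<Longrightarrow> mult_op (mpoly_ring n) f \<in> endos n"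
  by (intro endosI) (auto simp: mult_op_def algebra_simps)

lemma comm_mult_endos:
  fixes \<xi> :: "'k::field mpol \<Rightarrow> 'k mpol"
  assumes "\<xi> \<in> endos n" "f \<in> Pol n"
  shows "comm_mult n \<xi> f \<in> endos n"
proof (rule endosI)
  fix c :: 'k and x :: "'k mpol" assume "x \<in> Pol n"
  then have "\<xi> (f * (monomial 0 c * x)) = monomial 0 c * \<xi> (f * x)"
    using endosD(4)[OF assms(1), of "f * x" c] assms by (simp add: mult.left_commute)
  then show "comm_mult n \<xi> f (monomial 0 c * x) = monomial 0 c * comm_mult n \<xi> f x"
    using \<open>x \<in> Pol n\<close> assms
    by (simp add: comm_mult_def endosD right_diff_distrib mult.left_commute)
qed (use assms in \<open>auto simp: comm_mult_def endosD algebra_simps\<close>)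

lemma commutator_mult_op:
  fixes \<xi> :: "'k::field mpol \<Rightarrow> 'k mpol"
  assumes "\<xi> \<in> endos n" "f \<in> Pol n"
  shows "commutator (End_ring (ring_of_type_algebra :: 'k ring) (mpoly_ring n)) \<xi> (mult_op (mpoly_ring n) f)
    = comm_mult n \<xi> f"
proof -
  interpret algebra "ring_of_type_algebra :: 'k ring" "mpoly_ring n :: ('k, _) module"
    by (rule mpoly_ring_algebra)
  interpret E: ring "End_ring (ring_of_type_algebra :: 'k ring) (mpoly_ring n)"
    by (rule End_ring_is_ring)
  have m: "mult_op (mpoly_ring n) f \<in> endos n" by (rule mult_op_endos) fact
  have "commutator (End_ring (ring_of_type_algebra :: 'k ring) (mpoly_ring n)) \<xi> (mult_op (mpoly_ring n) f)
      \<in> carrier (End_ring (ring_of_type_algebra :: 'k ring) (mpoly_ring n))"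
    unfolding commutator_def by (intro E.minus_closed E.m_closed) (use assms m in \<open>auto simp: End_ring_def\<close>)
  then have c: "commutator (End_ring (ring_of_type_algebra :: 'k ring) (mpoly_ring n)) \<xi> (mult_op (mpoly_ring n) f)
      \<in> endos n" by (simp add: End_ring_def)
  have minus: "a \<ominus>\<^bsub>mpoly_ring n\<^esub> b = a - b" if "a \<in> Pol n" "b \<in> Pol n" for a b :: "'k mpol"
  proof -
    have "\<ominus>\<^bsub>mpoly_ring n\<^esub> b = - b"
      by (rule M.minus_equality) (use that in auto)
    then show ?thesis by (simp add: a_minus_def)
  qed
  show ?thesis
  proof (rule linear_endos_eqI[OF c comm_mult_endos[OF assms]])
    fix x :: "'k mpol" assume x: "x \<in> Pol n"
    show "commutator (End_ring (ring_of_type_algebra :: 'k ring) (mpoly_ring n)) \<xi> (mult_op (mpoly_ring n) f) x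
      = comm_mult n \<xi> f x"
      unfolding commutator_End_ring_apply[OF assms(1) m x]
      using x assms by (simp add: minus endosD mult_op_def comm_mult_def)
  qed
qed

lemma carrier_End_ring: "carrier (End_ring K M) = linear_endos K M"
  by (simp add: End_ring_def)

lemma dops_0: "dops n 0 = mult_op (mpoly_ring n) ` Pol n"
  by simp

lemma dops_Suc: "dops n (Suc m) = {\<xi> \<in> endos n. \<forall>f\<in>Pol n. comm_mult n \<xi> f \<in> dops n m}"
  by (auto simp: carrier_End_ring commutator_mult_op)

declare diff_ops_le.simps [simp del]

lemma dops_subset_endos: "dops n m \<subseteq> endos n"
  by (cases m) (auto simp: dops_Suc dops_0 mult_op_endos)

lemma dops_endos: "\<xi> \<in> dops n m \<Longrightarrow> \<xi> \<in> endos n"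
  using dops_subset_endos by blast

lemma all_dops_endos: "\<xi> \<in> all_dops n \<Longrightarrow> \<xi> \<in> endos n"
  unfolding all_dops_def using dops_subset_endos by blast

section \<open>Closure properties of the order filtration\<close>

lemma dops_add:
  "\<xi> \<in> dops n m \<Longrightarrow> \<eta> \<in> dops n m \<Longrightarrow> (\<lambda>x\<in>Pol n. \<xi> x + \<eta> x) \<in> dops n m"
proof (induction m arbitrary: \<xi> \<eta>)
  case 0
  then obtain f g where "f \<in> Pol n" "g \<in> Pol n"
    "\<xi> = mult_op (mpoly_ring n) f" "\<eta> = mult_op (mpoly_ring n) g" by (auto simp: dops_0)
  then show ?case
    unfolding dops_0 by (intro image_eqI[of _ _ "f + g"]) (auto simp: mult_op_def algebra_simps)
next
  case (Suc m)
  have e: "\<xi> \<in> endos n" "\<eta> \<in> endos n" using Suc.prems by (auto intro: dops_endos)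
  have "comm_mult n (\<lambda>x\<in>Pol n. \<xi> x + \<eta> x) f = (\<lambda>x\<in>Pol n. comm_mult n \<xi> f x + comm_mult n \<eta> f x)"
    if "f \<in> Pol n" for f
    using that by (auto simp: comm_mult_def algebra_simps)
  moreover have "(\<lambda>x\<in>Pol n. \<xi> x + \<eta> x) \<in> endos n"
    by (intro endosI) (auto simp: endosD[OF e(1)] endosD[OF e(2)] distrib_left add_ac)
  ultimately show ?case using Suc by (simp add: dops_Suc del: restrict_apply)
qed

lemma dops_mult_left:
  "\<xi> \<in> dops n m \<Longrightarrow> g \<in> Pol n \<Longrightarrow> (\<lambda>x\<in>Pol n. g * \<xi> x) \<in> dops n m"
proof (induction m arbitrary: \<xi>)
  case 0
  then obtain f where "f \<in> Pol n" "\<xi> = mult_op (mpoly_ring n) f" by (auto simp: dops_0)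
  then show ?case
    unfolding dops_0 using 0 by (intro image_eqI[of _ _ "g * f"]) (auto simp: mult_op_def algebra_simps)
next
  case (Suc m)
  have e: "\<xi> \<in> endos n" using Suc.prems by (auto intro: dops_endos)
  have "comm_mult n (\<lambda>x\<in>Pol n. g * \<xi> x) f = (\<lambda>x\<in>Pol n. g * comm_mult n \<xi> f x)"
    if "f \<in> Pol n" for f
    using that by (auto simp: comm_mult_def algebra_simps)
  moreover have "(\<lambda>x\<in>Pol n. g * \<xi> x) \<in> endos n"
    by (intro endosI) (use Suc.prems in \<open>auto simp: endosD[OF e] distrib_left mult.left_commute\<close>)
  ultimately show ?case using Suc by (simp add: dops_Suc del: restrict_apply)
qed

lemma dops_mult_right:
  "\<xi> \<in> dops n m \<Longrightarrow> g \<in> Pol n \<Longrightarrow> (\<lambda>x\<in>Pol n. \<xi> (g * x)) \<in> dops n m"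
proof (induction m arbitrary: \<xi>)
  case 0
  then obtain f where "f \<in> Pol n" "\<xi> = mult_op (mpoly_ring n) f" by (auto simp: dops_0)
  then show ?case
    unfolding dops_0 using 0 by (intro image_eqI[of _ _ "g * f"]) (auto simp: mult_op_def algebra_simps)
next
  case (Suc m)
  have e: "\<xi> \<in> endos n" using Suc.prems by (auto intro: dops_endos)
  have "comm_mult n (\<lambda>x\<in>Pol n. \<xi> (g * x)) f = (\<lambda>x\<in>Pol n. comm_mult n \<xi> f (g * x))"
    if "f \<in> Pol n" for f
    using that Suc.prems by (auto simp: comm_mult_def algebra_simps)
  moreover have "(\<lambda>x\<in>Pol n. \<xi> (g * x)) \<in> endos n"
    using Suc.prems
    by (intro endosI)
      (auto simp: endosD[OF e] distrib_left mult.left_commute[of g "monomial 0 _"])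
  ultimately show ?case using Suc by (simp add: dops_Suc del: restrict_apply)
qed

lemma zero_dops_0: "(\<lambda>x\<in>Pol n. 0) \<in> dops n 0"
  unfolding dops_0 by (rule image_eqI[of _ _ 0]) (auto simp: mult_op_def)

lemma dops_mono_Suc: "dops n m \<subseteq> dops n (Suc m)"
proof (induction m)
  case 0
  have "comm_mult n (mult_op (mpoly_ring n) f) g = (\<lambda>x\<in>Pol n. 0)"
    if "f \<in> Pol n" "g \<in> Pol n" for f g :: "'a mpol"
    using that by (auto simp: comm_mult_def mult_op_def algebra_simps)
  then have "mult_op (mpoly_ring n) f \<in> dops n (Suc 0)" if "f \<in> Pol n" for f :: "'a mpol"
    unfolding dops_Suc using that zero_dops_0 mult_op_endos by (auto simp del: restrict_apply)
  then show ?case unfolding dops_0 by blast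
next
  case (Suc m)
  then show ?case by (subst (1 2) dops_Suc) blast
qed

lemma dops_mono: "m \<le> m' \<Longrightarrow> dops n m \<subseteq> dops n m'"
  using lift_Suc_mono_le[of "dops n", OF dops_mono_Suc] .

lemma zero_dops: "(\<lambda>x\<in>Pol n. 0) \<in> dops n m"
  using zero_dops_0 dops_mono[of 0 m n] by blast

lemma var_Pol: "i < n \<Longrightarrow> var i \<in> Pol n"
  by (intro single_in_carrier exps_single)

text \<open>The \<open>f\<close> with \<open>[\<xi>, f] \<in> D\<^sup>m\<close> form a subalgebra, so it suffices to test the variables.\<close>

lemma dops_SucI:
  assumes \<xi>: "\<xi> \<in> endos n" and var: "\<And>i. i < n \<Longrightarrow> comm_mult n \<xi> (var i) \<in> dops n m"
  shows "\<xi> \<in> dops n (Suc m)"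
proof -
  have "comm_mult n \<xi> f \<in> dops n m" if "f \<in> Pol n" for f
    using that
  proof (induction rule: mpoly_ring_induct)
    case (add F G)
    have "comm_mult n \<xi> (F + G) = (\<lambda>x\<in>Pol n. comm_mult n \<xi> F x + comm_mult n \<xi> G x)"
      using add by (auto simp: comm_mult_def endosD[OF \<xi>] algebra_simps)
    then show ?case using dops_add[OF add(3,4)] by metis
  next
    case (monomial a c)
    then show ?case
    proof (induction rule: exps_induct)
      case zero
      have "comm_mult n \<xi> (monomial 0 c) = (\<lambda>x\<in>Pol n. 0)"
        by (auto simp: comm_mult_def endosD[OF \<xi>])
      then show ?case by (metis zero_dops)
    next
      case (add i a)
      let ?F = "var i" and ?G = "monomial a c"
      have F: "?F \<in> Pol n" using add var_Pol by blast
      have G: "?G \<in> Pol n" using add single_in_carrier by blast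
      \<comment> \<open>The Leibniz rule
        \<open>[\<xi>, F G] = [\<xi>, F] G + F [\<xi>, G]\<close>.\<close>
      have "comm_mult n \<xi> (?F * ?G)
          = (\<lambda>x\<in>Pol n. (\<lambda>x\<in>Pol n. comm_mult n \<xi> ?F (?G * x)) x + (\<lambda>x\<in>Pol n. ?F * comm_mult n \<xi> ?G x) x)"
        using F G by (intro restrict_ext | simp add: comm_mult_def algebra_simps)+
      moreover have "?F * ?G = monomial (a + monomial i 1) c"
        by (simp add: mult_single add.commute)
      ultimately show ?case
        using dops_add[OF dops_mult_right[OF var[OF add(1)] G] dops_mult_left[OF add(3) F]] by metis
    qed
  qed
  with \<xi> show ?thesis by (simp add: dops_Suc)
qed

section \<open>Divided power derivatives as differential operators\<close>

abbreviation dpd_op :: "nat \<Rightarrow> (nat \<Rightarrow>\<^sub>0 nat) \<Rightarrow> 'k::field mpol \<Rightarrow> 'k mpol" where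
  "dpd_op n a \<equiv> \<lambda>x\<in>Pol n. dpd n a x"

lemma dpd_op_endos: "dpd_op n a \<in> endos n"
  by (intro endosI) (auto simp: dpd_in_carrier dpd_add dpd_smult)

lemma comm_mult_dpd_op:
  assumes "i < n"
  shows "comm_mult n (dpd_op n (a + monomial i 1)) (var i) = dpd_op n a"
    and "coef a i = 0 \<Longrightarrow> comm_mult n (dpd_op n a) (var i) = (\<lambda>x\<in>Pol n. 0)"
  unfolding comm_mult_def
  by (auto intro!: restrict_ext simp: var_Pol[OF assms] dpd_commutator[OF assms] dpd_commute[OF assms]
      simp del: One_nat_def)

text \<open>The commutator with \<open>x_i\<close> is zero or the derivative with \<open>a_i\<close>
  lowered by one, so the total degree of \<open>a\<close> bounds the order.\<close>

lemma dpd_op_dops: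
  "a \<in> exps n \<Longrightarrow> (dpd_op n a :: 'k::field mpol \<Rightarrow> 'k mpol) \<in> dops n (\<Sum>i<n. coef a i)"
proof (induction "\<Sum>i<n. coef a i" arbitrary: a)
  case 0
  then have "a = 0" by (intro poly_mapping_eqI) (auto simp: exps_iff not_less[symmetric])
  then have "(dpd_op n a :: 'k mpol \<Rightarrow> _) = mult_op (mpoly_ring n) 1" by (auto simp: mult_op_def dpd_0)
  then have "(dpd_op n a :: 'k mpol \<Rightarrow> _) \<in> dops n 0" by (auto simp: dops_0 simp del: restrict_apply)
  then show ?case using 0 by metis
next
  case (Suc d)
  have "(dpd_op n a :: 'k mpol \<Rightarrow> _) \<in> dops n (Suc d)"
  proof (rule dops_SucI[OF dpd_op_endos])
    fix i assume i: "i < n"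
    show "comm_mult n (dpd_op n a :: 'k mpol \<Rightarrow> _) (var i) \<in> dops n d"
    proof (cases "coef a i = 0")
      case True
      then show ?thesis using comm_mult_dpd_op(2)[OF i True] zero_dops by metis
    next
      case False
      define b where "b = a - monomial i 1"
      have a: "a = b + monomial i 1"
        unfolding b_def using False
        by (auto intro!: poly_mapping_eqI simp: lookup_add lookup_minus lookup_single when_def)
      have "b \<in> exps n" using Suc by (auto simp: b_def)
      moreover have "(\<Sum>j<n. coef a j) = (\<Sum>j<n. coef b j) + 1"
        using i by (simp add: a lookup_add sum.distrib lookup_single when_def)
      ultimately have "d = (\<Sum>j<n. coef b j)" using Suc.hyps(2) by simp
      from Suc.hyps(1)[OF this \<open>b \<in> exps n\<close>] have "(dpd_op n b :: 'k mpol \<Rightarrow> _) \<in> dops n d" unfolding \<open>d = _\<close> .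
      then show ?thesis unfolding a comm_mult_dpd_op(1)[OF i] .
    qed
  qed
  then show ?case using Suc by metis
qed

text \<open>
  If \<open>h = f ^ (p ^ m)\<close> commutes with \<open>[\<xi>, h]\<close>, then \<open>[\<xi>, h ^ p] = p h ^ (p - 1) [\<xi>, h] = 0\<close>.
\<close>

lemma dops_commute_power:
  assumes p: "prime p" "CHAR('k::field) = p"
  shows "\<xi> \<in> dops n m \<Longrightarrow> f \<in> Pol n \<Longrightarrow> x \<in> Pol n \<Longrightarrow>
    \<xi> (f ^ (p ^ m) * x) = f ^ (p ^ m) * (\<xi> x :: 'k mpol)"
proof (induction m arbitrary: \<xi> x)
  case 0
  then show ?case by (auto simp: dops_0 mult_op_def algebra_simps)
next
  case (Suc m)
  note IH = Suc.IH
  define h where "h = f ^ (p ^ m)"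
  have pow: "g ^ k \<in> Pol n" if "g \<in> Pol n" for g :: "'k mpol" and k
    using that by (induction k) auto
  have h: "h \<in> Pol n" using Suc.prems pow by (simp add: h_def)
  define \<eta> where "\<eta> = comm_mult n \<xi> h"
  have \<eta>: "\<eta> \<in> dops n m" using Suc.prems h by (auto simp: dops_Suc \<eta>_def)
  have \<xi>h: "\<xi> (h * y) = h * \<xi> y + \<eta> y" if "y \<in> Pol n" for y
    using that by (simp add: \<eta>_def comm_mult_def)
  \<comment> \<open>Since \<open>\<eta>\<close> has order at most \<open>m\<close>, the induction
    hypothesis lets it commute with \<open>h = f ^ (p ^ m)\<close>.\<close>
  have \<eta>h: "\<eta> (h ^ k * y) = h ^ k * \<eta> y" if "y \<in> Pol n" for k y
    using that
  proof (induction k)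
    case (Suc k)
    then have "\<eta> (h * (h ^ k * y)) = h * \<eta> (h ^ k * y)"
      unfolding h_def using Suc.prems \<open>f \<in> Pol n\<close> \<eta> by (intro IH) (auto intro!: pow)
    then show ?case using Suc by (simp add: mult.assoc)
  qed simp
  have "\<xi> (h ^ Suc k * x) = h ^ Suc k * \<xi> x + of_nat (Suc k) * h ^ k * \<eta> x" for k
  proof (induction k)
    case 0
    then show ?case using \<xi>h Suc.prems by simp
  next
    case (Suc k)
    have "h ^ Suc k * x \<in> Pol n" by (intro mpoly_ring_closed pow h \<open>x \<in> Pol n\<close>)
    from \<xi>h[OF this] show ?case
      using Suc \<eta>h[OF \<open>x \<in> Pol n\<close>, of "Suc k"] by (simp add: algebra_simps)
  qed
  moreover have "(of_nat p :: 'k mpol) = 0"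
    using p by (metis of_nat_CHAR single_of_nat single_zero)
  moreover obtain k where "p = Suc k" using p by (metis gr0_implies_Suc prime_gt_0_nat)
  ultimately have "\<xi> (h ^ p * x) = h ^ p * \<xi> x" by (metis add.right_neutral mult_zero_left)
  then show ?case by (simp add: h_def mult.commute flip: power_mult)
qed

subsection \<open>Linearity over \<open>R\<^sup>q\<close>\<close>

text \<open>Linearity over the subring generated by the constants and the \<open>x_i^q\<close>;
  linearity over the constants is part of \<open>endos\<close>, so monomials suffice.\<close>

definition qlin :: "nat \<Rightarrow> nat \<Rightarrow> ('k::field mpol \<Rightarrow> 'k mpol) set" where
  "qlin n q = {\<xi> \<in> endos n. \<forall>c\<in>exps n. (\<forall>i. q dvd coef c i) \<longrightarrow>
     (\<forall>x\<in>Pol n. \<xi> (monomial c 1 * x) = monomial c 1 * \<xi> x)}"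

lemma qlin_mono: "q dvd q' \<Longrightarrow> qlin n q \<subseteq> qlin n q'"
  unfolding qlin_def using dvd_trans[of q q'] by blast

lemma qlin_compose:
  assumes "\<xi> \<in> qlin n q" "\<eta> \<in> qlin n q"
  shows "compose (Pol n) \<xi> \<eta> \<in> qlin n q"
proof -
  have e: "\<xi> \<in> endos n" "\<eta> \<in> endos n" using assms by (auto simp: qlin_def)
  have "compose (Pol n) \<xi> \<eta> \<in> endos n"
    by (intro endosI) (auto simp: compose_def endosD[OF e(1)] endosD[OF e(2)])
  with assms show ?thesis
    by (auto simp: qlin_def compose_def single_in_carrier endosD[OF e(2)])
qed

lemma monomial_power:
  "(monomial m (1::'k::field)) ^ k = monomial (Poly_Mapping.map ((*) k) m) 1"
proof (induction k)
  case 0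
  have "Poly_Mapping.map ((*) 0) m = (0 :: _ \<Rightarrow>\<^sub>0 nat)"
    by (rule poly_mapping_eqI) (simp add: Poly_Mapping.map.rep_eq when_def)
  then show ?case by (simp only: power_0 single_one)
next
  case (Suc k)
  have "Poly_Mapping.map ((*) (Suc k)) m = m + Poly_Mapping.map ((*) k) m"
    by (rule poly_mapping_eqI) (simp add: Poly_Mapping.map.rep_eq when_def lookup_add)
  with Suc show ?case by (simp only: power_Suc mult_single mult_1)
qed

text \<open>A monomial whose exponents are divisible by \<open>p ^ m\<close> is the
  \<open>p ^ m\<close>-th power of a monomial.\<close>

lemma dops_qlin:
  assumes "prime p" "CHAR('k::field) = p"
  shows "dops n m \<subseteq> (qlin n (p ^ m) :: ('k mpol \<Rightarrow> _) set)"
proof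
  fix \<xi> :: "'k mpol \<Rightarrow> 'k mpol" assume \<xi>: "\<xi> \<in> dops n m"
  have "\<xi> (monomial c 1 * x) = monomial c 1 * \<xi> x"
    if c: "c \<in> exps n" "\<forall>i. p ^ m dvd coef c i" and x: "x \<in> Pol n" for c x
  proof -
    define d where "d = Poly_Mapping.map (\<lambda>v. v div p ^ m) c"
    have "c = Poly_Mapping.map ((*) (p ^ m)) d"
    proof (rule poly_mapping_eqI)
      fix i
      have "coef c i = p ^ m * (coef c i div p ^ m)" using c(2) by simp
      moreover from this have "coef c i div p ^ m = 0 \<Longrightarrow> coef c i = 0" by (metis mult_0_right)
      ultimately show "coef c i = coef (Poly_Mapping.map ((*) (p ^ m)) d) i"
        by (cases "coef c i = 0") (auto simp: d_def Poly_Mapping.map.rep_eq when_def)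
    qed
    then have "monomial c (1::'k) = monomial d 1 ^ (p ^ m)" by (simp add: monomial_power)
    moreover have "d \<in> exps n" using c by (simp add: exps_iff d_def Poly_Mapping.map.rep_eq when_def)
    ultimately show ?thesis
      using dops_commute_power[OF assms \<xi> _ x] by (simp add: single_in_carrier)
  qed
  then show "\<xi> \<in> qlin n (p ^ m)" using \<xi> by (auto simp: qlin_def dops_endos)
qed

text \<open>On \<open>x^m\<close>, duality singles out the summand at \<open>mod_exp q m\<close>,
  and linearity moves the \<open>q\<close>-divisible factor back inside
  \<open>\<xi>\<close>.\<close>

lemma qlin_expand:
  assumes p: "prime p" "CHAR('k::field) = p" and q: "q = p ^ e"
    and \<xi>: "\<xi> \<in> qlin n q" and x: "x \<in> Pol n"
  shows "\<xi> x = (\<Sum>a\<in>cube n q. \<xi> (monomial a 1) * tr n q (monomial (box n q - a) 1 * (x :: 'k mpol)))"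
proof -
  have e: "\<xi> \<in> endos n" using \<xi> by (simp add: qlin_def)
  have q0: "q > 0" using p q by (simp add: prime_gt_0_nat)
  show ?thesis
    using x
  proof (induction rule: mpoly_ring_induct)
    case (add F G)
    then show ?case by (simp add: endosD[OF e] algebra_simps dpd_add sum.distrib)
  next
    case (monomial m c)
    have r: "mod_exp q m \<in> cube n q" using mod_exp_cube[OF q0 monomial] .
    then have r': "mod_exp q m \<in> exps n" by (simp add: cube_def)
    have m: "monomial (m - mod_exp q m) 1 * monomial (mod_exp q m) 1 = monomial m (1::'k)"
    proof -
      have "m - mod_exp q m + mod_exp q m = m"
        by (rule poly_mapping_eqI) (simp add: lookup_add lookup_minus)
      then show ?thesis by (simp add: mult_single)
    qed
    have "(\<Sum>a\<in>cube n q. \<xi> (monomial a 1) * tr n q (monomial (box n q - a) 1 * monomial m (1::'k)))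
       = (\<Sum>a\<in>cube n q. if a = mod_exp q m then \<xi> (monomial a 1) * monomial (m - mod_exp q m) 1 else 0)"
      by (intro sum.cong refl) (simp add: tr_dual_monom[OF p q monomial])
    also have "\<dots> = \<xi> (monomial (mod_exp q m) 1) * monomial (m - mod_exp q m) 1"
      using r by simp
    also have "\<dots> = \<xi> (monomial (m - mod_exp q m) 1 * monomial (mod_exp q m) 1)"
      using \<xi> monomial r' by (auto simp: qlin_def single_in_carrier lookup_minus mult.commute)
    also have "\<dots> = \<xi> (monomial m 1)" by (simp only: m)
    finally have 1: "\<xi> (monomial m 1)
      = (\<Sum>a\<in>cube n q. \<xi> (monomial a 1) * tr n q (monomial (box n q - a) 1 * monomial m (1::'k)))" ..
    \<comment> \<open>The duality was used for coefficient \<open>1\<close>; the scalar is put back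
      by linearity.\<close>
    have c: "monomial m c = monomial 0 c * monomial m 1" by (simp add: mult_single)
    have "\<xi> (monomial m c) = monomial 0 c * \<xi> (monomial m 1)"
      unfolding c using monomial by (simp only: endosD[OF e] single_in_carrier)
    also have "\<dots> = (\<Sum>a\<in>cube n q. \<xi> (monomial a 1) *
        (monomial 0 c * tr n q (monomial (box n q - a) 1 * monomial m (1::'k))))"
      unfolding 1 sum_distrib_left by (simp only: mult.left_commute)
    also have "\<dots> = (\<Sum>a\<in>cube n q. \<xi> (monomial a 1) * tr n q (monomial (box n q - a) 1 * monomial m c))"
      unfolding c dpd_smult[symmetric] by (simp only: mult.left_commute)
    finally show ?case .
  qed
qed

text \<open>Keeping the two families of multipliers separate makes taking adjoints a swap of
  \<open>u\<close> and \<open>v\<close>.\<close>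

definition sandwich :: "nat \<Rightarrow> nat \<Rightarrow> 'a set \<Rightarrow> ('a \<Rightarrow> 'k::field mpol) \<Rightarrow> ('a \<Rightarrow> 'k mpol) \<Rightarrow> 'k mpol \<Rightarrow> 'k mpol" where
  "sandwich n q A u v = (\<lambda>x\<in>Pol n. \<Sum>a\<in>A. u a * tr n q (v a * x))"

text \<open>Multiplying on either side does not raise the order, so all summands have the order
  bound of the trace.\<close>

lemma sandwich_dops:
  fixes u v :: "'a \<Rightarrow> 'k::field mpol"
  assumes "\<And>a. a \<in> A \<Longrightarrow> u a \<in> Pol n" "\<And>a. a \<in> A \<Longrightarrow> v a \<in> Pol n"
  shows "sandwich n q A u v \<in> all_dops n"
proof -
  define m where "m = (\<Sum>i<n. coef (box n q) i)"
  have t: "(dpd_op n (box n q) :: 'k mpol \<Rightarrow> _) \<in> dops n m"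
    unfolding m_def by (rule dpd_op_dops) simp
  have "sandwich n q A u v \<in> dops n m"
    using assms
  proof (induction A rule: infinite_finite_induct)
    case (insert a A)
    then have u: "u a \<in> Pol n" and v: "v a \<in> Pol n" by auto
    have "sandwich n q (insert a A) u v
      = (\<lambda>x\<in>Pol n. (\<lambda>x\<in>Pol n. u a * (\<lambda>x\<in>Pol n. dpd_op n (box n q) (v a * x)) x) x + sandwich n q A u v x)"
      using insert u v by (auto simp: sandwich_def)
    moreover have "sandwich n q A u v \<in> dops n m" using insert by blast
    ultimately show ?case
      using dops_add[OF dops_mult_left[OF dops_mult_right[OF t v] u], of "sandwich n q A u v"]
      by (simp only:)
  qed (simp_all add: sandwich_def zero_dops)
  then show ?thesis by (rule all_dopsI)
qed

lemma qlin_eq_sandwich: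
  assumes "prime p" "CHAR('k::field) = p" "q = p ^ e" and \<xi>: "\<xi> \<in> qlin n q"
  shows "\<xi> = sandwich n q (cube n q) (\<lambda>a. \<xi> (monomial a 1)) (\<lambda>a. monomial (box n q - a) (1::'k))"
proof
  fix x
  show "\<xi> x = sandwich n q (cube n q) (\<lambda>a. \<xi> (monomial a 1)) (\<lambda>a. monomial (box n q - a) (1::'k)) x"
  proof (cases "x \<in> Pol n")
    case True
    then show ?thesis using qlin_expand[OF assms True] by (simp add: sandwich_def)
  next
    case False
    have "\<xi> \<in> extensional (Pol n)" using \<xi> by (intro endosD(1)) (simp add: qlin_def)
    from extensional_arb[OF this False] show ?thesis using False by (simp add: sandwich_def)
  qed
qed

lemma qlin_dops:
  assumes "prime p" "CHAR('k::field) = p" "\<xi> \<in> qlin n (p ^ e)"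
  shows "(\<xi> :: 'k mpol \<Rightarrow> _) \<in> all_dops n"
proof -
  have "\<xi> \<in> endos n" using assms by (simp add: qlin_def)
  then have "sandwich n (p ^ e) (cube n (p ^ e)) (\<lambda>a. \<xi> (monomial a 1))
      (\<lambda>a. monomial (box n (p ^ e) - a) (1::'k)) \<in> all_dops n"
    by (intro sandwich_dops endosD(2)[of \<xi>] single_in_carrier) (auto simp: cube_def)
  then show ?thesis using qlin_eq_sandwich[OF assms(1,2) refl assms(3)] by (simp only:)
qed

lemma all_dops_eq:
  assumes "prime p" "CHAR('k::field) = p"
  shows "all_dops n = (\<Union>e. qlin n (p ^ e) :: ('k mpol \<Rightarrow> _) set)"
proof
  show "all_dops n \<subseteq> (\<Union>e. qlin n (p ^ e) :: ('k mpol \<Rightarrow> _) set)"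
    unfolding all_dops_def using dops_qlin[OF assms] by (rule UN_mono[OF subset_refl])
  show "(\<Union>e. qlin n (p ^ e) :: ('k mpol \<Rightarrow> _) set) \<subseteq> all_dops n"
    by (intro UN_least subsetI qlin_dops[OF assms])
qed

text \<open>Read off from \<open>qlin\<close> rather than from the order filtration: both factors
  are linear over the larger of the two powers.\<close>

lemma all_dops_compose:
  assumes "prime p" "CHAR('k::field) = p" "\<xi> \<in> all_dops n" "\<eta> \<in> all_dops n"
  shows "compose (Pol n) \<xi> (\<eta> :: 'k mpol \<Rightarrow> _) \<in> all_dops n"
proof -
  from assms obtain d e where "\<xi> \<in> qlin n (p ^ d)" "\<eta> \<in> qlin n (p ^ e)"
    unfolding all_dops_eq[OF assms(1,2)] by blast
  then have "\<xi> \<in> qlin n (p ^ max d e)" "\<eta> \<in> qlin n (p ^ max d e)"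
    using qlin_mono[OF le_imp_power_dvd[of d "max d e" p]] qlin_mono[OF le_imp_power_dvd[of e "max d e" p]]
    by auto
  then show ?thesis unfolding all_dops_eq[OF assms(1,2)] by (blast intro: qlin_compose)
qed

lemma all_dops_add:
  assumes "\<xi> \<in> all_dops n" "\<eta> \<in> all_dops n"
  shows "(\<lambda>x\<in>Pol n. \<xi> x + \<eta> x) \<in> all_dops n"
proof -
  from assms obtain d e where "\<xi> \<in> dops n d" "\<eta> \<in> dops n e"
    unfolding all_dops_def by blast
  then have "\<xi> \<in> dops n (max d e)" "\<eta> \<in> dops n (max d e)"
    using dops_mono[of d "max d e" n] dops_mono[of e "max d e" n] by auto
  then show ?thesis by (intro all_dopsI[of _ _ "max d e"] dops_add)
qed

subsection \<open>Adjoints\<close>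

text \<open>In characteristic \<open>p\<close>, with \<open>q\<close> a power of \<open>p\<close>,
  the form \<open>corner_part n q (f * g)\<close> is the trace form \<open>tr n q (f * g)\<close>
  multiplied by the monomial with exponent \<open>box n q\<close>.\<close>

definition adj :: "nat \<Rightarrow> nat \<Rightarrow> ('k::field mpol \<Rightarrow> 'k mpol) \<Rightarrow> ('k mpol \<Rightarrow> 'k mpol) \<Rightarrow> bool" where
  "adj n q \<xi> \<eta> \<longleftrightarrow> (\<forall>f\<in>Pol n. \<forall>g\<in>Pol n. corner_part n q (\<xi> f * g) = corner_part n q (f * \<eta> g))"

lemma adjD:
  "adj n q \<xi> \<eta> \<Longrightarrow> f \<in> Pol n \<Longrightarrow> g \<in> Pol n \<Longrightarrow> corner_part n q (\<xi> f * g) = corner_part n q (f * \<eta> g)"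
  by (simp add: adj_def)

lemma adj_dvd: "adj n q \<xi> \<eta> \<Longrightarrow> q dvd q' \<Longrightarrow> adj n q' \<xi> \<eta>"
  unfolding adj_def by (metis (no_types) corner_part_corner_part)

lemma adj_sym: "adj n q \<xi> \<eta> \<Longrightarrow> adj n q \<eta> \<xi>"
  unfolding adj_def by (metis mult.commute)

lemma adj_unique:
  fixes \<xi> \<eta> \<eta>' :: "'k::field mpol \<Rightarrow> 'k mpol"
  assumes "adj n q \<xi> \<eta>" "adj n q \<xi> \<eta>'" "\<eta> \<in> endos n" "\<eta>' \<in> endos n" "q > 0"
  shows "\<eta> = \<eta>'"
proof (rule linear_endos_eqI[OF assms(3,4)])
  fix g :: "'k mpol" assume g: "g \<in> Pol n"
  have "\<eta> g - \<eta>' g = 0"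
  proof (rule corner_part_nondegenerate[where n = n, OF _ \<open>q > 0\<close>])
    fix f :: "'k mpol" assume f: "f \<in> Pol n"
    have "corner_part n q (f * (\<eta> g - \<eta>' g)) + corner_part n q (f * \<eta>' g) = corner_part n q (f * \<eta> g)"
      by (simp add: right_diff_distrib flip: corner_part_add)
    then show "corner_part n q (f * (\<eta> g - \<eta>' g)) = 0"
      using adjD[OF assms(1) f g] adjD[OF assms(2) f g] by simp
  qed (use assms g in \<open>auto intro: endosD(2)\<close>)
  then show "\<eta> g = \<eta>' g" by simp
qed

text \<open>Multiplications pass across the form and the trace is self-adjoint, so each summand is
  reversed.\<close>

lemma adj_sandwich:
  fixes u v :: "'a \<Rightarrow> 'k::field mpol"
  assumes "prime p" "CHAR('k) = p" "q = p ^ e"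
    and "\<And>a. a \<in> A \<Longrightarrow> u a \<in> Pol n" "\<And>a. a \<in> A \<Longrightarrow> v a \<in> Pol n"
  shows "adj n q (sandwich n q A u v) (sandwich n q A v u)"
  unfolding adj_def
proof (intro ballI)
  fix f g :: "'k mpol" assume f: "f \<in> Pol n" and g: "g \<in> Pol n"
  have "corner_part n q (sandwich n q A u v f * g)
      = (\<Sum>a\<in>A. corner_part n q (tr n q (v a * f) * (u a * g)))"
    using f by (simp add: sandwich_def sum_distrib_right mult.assoc mult.left_commute flip: corner_part_sum)
  also have "\<dots> = (\<Sum>a\<in>A. corner_part n q ((v a * f) * tr n q (u a * g)))"
    using assms f g by (intro sum.cong refl tr_self_adjoint[OF assms(1-3)]) auto
  also have "\<dots> = corner_part n q (f * sandwich n q A v u g)"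
    using g by (simp add: sandwich_def sum_distrib_left mult.assoc mult.left_commute flip: corner_part_sum)
  finally show "corner_part n q (sandwich n q A u v f * g) = corner_part n q (f * sandwich n q A v u g)" .
qed

section \<open>The adjoint map on differential operators\<close>

locale prime_char =
  fixes p n :: nat and field_type :: "'k::field itself"
  assumes prime_p: "prime p" and CHAR_p: "CHAR('k) = p"
begin

lemma p_pow_pos: "p ^ e > 0"
  using prime_p by (simp add: prime_gt_0_nat)

lemma adj_exists:
  assumes "\<xi> \<in> (all_dops n :: ('k mpol \<Rightarrow> _) set)"
  shows "\<exists>\<eta>\<in>all_dops n. \<exists>e. adj n (p ^ e) \<xi> \<eta>"
proof -
  obtain e where \<xi>: "\<xi> \<in> qlin n (p ^ e)"
    using assms unfolding all_dops_eq[OF prime_p CHAR_p] by blast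
  then have "\<xi> \<in> endos n" by (simp add: qlin_def)
  then have u: "\<xi> (monomial a 1) \<in> Pol n" if "a \<in> cube n (p ^ e)" for a
    using that by (intro endosD(2)[of \<xi>] single_in_carrier) (auto simp: cube_def)
  have v: "monomial (box n (p ^ e) - a) (1::'k) \<in> Pol n" for a
    by (intro single_in_carrier) auto
  have "adj n (p ^ e) \<xi> (sandwich n (p ^ e) (cube n (p ^ e)) (\<lambda>a. monomial (box n (p ^ e) - a) 1)
      (\<lambda>a. \<xi> (monomial a 1)))"
    \<comment> \<open>Only the first \<open>\<xi>\<close> is expanded, since \<open>\<xi>\<close>
      also occurs in the multipliers of the swapped sandwich.\<close>
    by (subst (1) qlin_eq_sandwich[OF prime_p CHAR_p refl \<xi>])
      (rule adj_sandwich[OF prime_p CHAR_p refl u v])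
  moreover have "sandwich n (p ^ e) (cube n (p ^ e)) (\<lambda>a. monomial (box n (p ^ e) - a) 1)
      (\<lambda>a. \<xi> (monomial a 1)) \<in> all_dops n"
    by (rule sandwich_dops[OF v u])
  ultimately show ?thesis by blast
qed

lemma adj_common:
  assumes "adj n (p ^ d) \<xi> \<eta>" "adj n (p ^ e) \<xi>' \<eta>'"
  shows "adj n (p ^ max d e) \<xi> \<eta>" "adj n (p ^ max d e) \<xi>' \<eta>'"
  by (rule adj_dvd[OF assms(1)] adj_dvd[OF assms(2)], simp add: le_imp_power_dvd)+

text \<open>The exponent \<open>e\<close> is left open; two candidates for different exponents are
  compared at the larger one, where nondegeneracy makes them equal.\<close>

definition adjoint :: "('k mpol \<Rightarrow> 'k mpol) \<Rightarrow> 'k mpol \<Rightarrow> 'k mpol" where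
  "adjoint = (\<lambda>\<xi>\<in>all_dops n. THE \<eta>. \<eta> \<in> all_dops n \<and> (\<exists>e. adj n (p ^ e) \<xi> \<eta>))"

lemma adjoint_eqI:
  assumes "\<xi> \<in> all_dops n" "\<eta> \<in> all_dops n" "adj n (p ^ e) \<xi> \<eta>"
  shows "adjoint \<xi> = \<eta>"
proof -
  have "(THE \<eta>. \<eta> \<in> all_dops n \<and> (\<exists>e. adj n (p ^ e) \<xi> \<eta>)) = \<eta>"
  proof (rule the_equality)
    fix \<eta>' assume "\<eta>' \<in> all_dops n \<and> (\<exists>e. adj n (p ^ e) \<xi> \<eta>')"
    then obtain d where \<eta>': "\<eta>' \<in> all_dops n" "adj n (p ^ d) \<xi> \<eta>'" by blast
    show "\<eta>' = \<eta>"
      using adj_common[OF \<eta>'(2) assms(3)] \<eta>'(1) assms(2) p_pow_pos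
      by (intro adj_unique[of n "p ^ max d e" \<xi> \<eta>' \<eta>]) (auto intro: all_dops_endos)
  qed (use assms in blast)
  with assms(1) show ?thesis by (simp only: adjoint_def restrict_apply')
qed

lemma adjoint:
  assumes "\<xi> \<in> all_dops n"
  shows "adjoint \<xi> \<in> all_dops n" "\<exists>e. adj n (p ^ e) \<xi> (adjoint \<xi>)"
proof -
  obtain \<eta> e where "\<eta> \<in> all_dops n" "adj n (p ^ e) \<xi> \<eta>" using adj_exists[OF assms] by blast
  with adjoint_eqI[OF assms this] show "adjoint \<xi> \<in> all_dops n" "\<exists>e. adj n (p ^ e) \<xi> (adjoint \<xi>)"
    by blast+
qed

text \<open>The form is symmetric. Being its own inverse makes \<open>adjoint\<close>
  bijective.\<close>

lemma adjoint_adjoint: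
  assumes "\<xi> \<in> all_dops n"
  shows "adjoint (adjoint \<xi>) = \<xi>"
proof -
  obtain e where "adj n (p ^ e) \<xi> (adjoint \<xi>)" using adjoint(2)[OF assms] by blast
  from adjoint_eqI[OF adjoint(1)[OF assms] assms adj_sym[OF this]] show ?thesis .
qed

lemma adjoint_add:
  assumes "\<xi> \<in> all_dops n" "\<eta> \<in> all_dops n"
  shows "adjoint (\<lambda>x\<in>Pol n. \<xi> x + \<eta> x) = (\<lambda>x\<in>Pol n. adjoint \<xi> x + adjoint \<eta> x)"
proof -
  obtain d e where "adj n (p ^ d) \<xi> (adjoint \<xi>)" "adj n (p ^ e) \<eta> (adjoint \<eta>)"
    using assms adjoint(2) by blast
  from adj_common[OF this]
  have "adj n (p ^ max d e) (\<lambda>x\<in>Pol n. \<xi> x + \<eta> x) (\<lambda>x\<in>Pol n. adjoint \<xi> x + adjoint \<eta> x)"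
    unfolding adj_def by (auto simp: distrib_left distrib_right corner_part_add)
  then show ?thesis
    by (rule adjoint_eqI[rotated 2]) (intro all_dops_add assms adjoint(1))+
qed

lemma adjoint_compose:
  assumes "\<xi> \<in> all_dops n" "\<eta> \<in> all_dops n"
  shows "adjoint (compose (Pol n) \<xi> \<eta>) = compose (Pol n) (adjoint \<eta>) (adjoint \<xi>)"
proof -
  obtain d e where "adj n (p ^ d) \<xi> (adjoint \<xi>)" "adj n (p ^ e) \<eta> (adjoint \<eta>)"
    using assms adjoint(2) by blast
  note a = adj_common[OF this]
  have P: "adjoint \<xi> x \<in> Pol n" "\<eta> x \<in> Pol n" if "x \<in> Pol n" for x
    using that assms adjoint(1)[of \<xi>] by (auto dest!: all_dops_endos intro: endosD(2))
  have "adj n (p ^ max d e) (compose (Pol n) \<xi> \<eta>) (compose (Pol n) (adjoint \<eta>) (adjoint \<xi>))"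
    unfolding adj_def by (auto simp: compose_def P adjD[OF a(1)] adjD[OF a(2)])
  then show ?thesis
    by (rule adjoint_eqI[rotated 2]) (intro all_dops_compose[OF prime_p CHAR_p] assms adjoint(1))+
qed

lemma mult_op_all_dops: "f \<in> Pol n \<Longrightarrow> mult_op (mpoly_ring n) f \<in> all_dops n"
  by (rule all_dopsI[of _ _ 0]) (simp add: dops_0)

lemma adjoint_mult_op:
  assumes "f \<in> Pol n" shows "adjoint (mult_op (mpoly_ring n) f) = mult_op (mpoly_ring n) f"
proof -
  \<comment> \<open>The two products inside \<open>corner_part\<close> coincide already, so the
    smallest exponent will do.\<close>
  have "adj n (p ^ 0) (mult_op (mpoly_ring n) f) (mult_op (mpoly_ring n) f)"
    by (auto simp: adj_def mult_op_def mult_ac)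
  then show ?thesis by (rule adjoint_eqI[OF mult_op_all_dops[OF assms] mult_op_all_dops[OF assms]])
qed

end

subsection \<open>Anti-automorphisms fixing the polynomials\<close>

text \<open>Collects what the uniqueness argument uses; both \<open>adjoint\<close> and an arbitrary
  anti-automorphism fixing the polynomials are instances.\<close>

locale fixing_anti_hom = prime_char p n field_type
  for p n :: nat and field_type :: "'k::field itself" +
  fixes \<Phi> :: "('k mpol \<Rightarrow> 'k mpol) \<Rightarrow> 'k mpol \<Rightarrow> 'k mpol"
  assumes closed: "\<xi> \<in> all_dops n \<Longrightarrow> \<Phi> \<xi> \<in> all_dops n"
    and add: "\<xi> \<in> all_dops n \<Longrightarrow> \<eta> \<in> all_dops n \<Longrightarrow>
      \<Phi> (\<lambda>x\<in>Pol n. \<xi> x + \<eta> x) = (\<lambda>x\<in>Pol n. \<Phi> \<xi> x + \<Phi> \<eta> x)"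
    and compose: "\<xi> \<in> all_dops n \<Longrightarrow> \<eta> \<in> all_dops n \<Longrightarrow>
      \<Phi> (compose (Pol n) \<xi> \<eta>) = compose (Pol n) (\<Phi> \<eta>) (\<Phi> \<xi>)"
    and inj: "inj_on \<Phi> (all_dops n)"
    and fixes_mult: "f \<in> Pol n \<Longrightarrow> \<Phi> (mult_op (mpoly_ring n) f) = mult_op (mpoly_ring n) f"
begin

lemma endos_image: "\<xi> \<in> all_dops n \<Longrightarrow> \<Phi> \<xi> \<in> endos n"
  by (intro all_dops_endos closed)

lemma zero: "\<Phi> (\<lambda>x\<in>Pol n. 0) = (\<lambda>x\<in>Pol n. 0)"
proof -
  have "mult_op (mpoly_ring n) 0 = (\<lambda>x\<in>Pol n. (0::'k mpol))"
    by (auto simp: mult_op_def)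
  then show ?thesis using fixes_mult[of 0] by (metis mpoly_ring_closed(5))
qed

text \<open>Applying \<open>\<Phi>\<close> to \<open>\<xi> f = \<eta> + f \<xi>\<close> reverses the
  products, so that \<open>[\<Phi> \<xi>, f] = - \<Phi> [\<xi>, f]\<close>.\<close>

lemma commutator_image:
  assumes \<xi>: "\<xi> \<in> all_dops n" and c: "comm_mult n \<xi> f = \<eta>" "\<eta> \<in> all_dops n"
    and f: "f \<in> Pol n" and x: "x \<in> Pol n"
  shows "\<Phi> \<xi> (f * x) = f * \<Phi> \<xi> x - \<Phi> \<eta> x"
proof -
  let ?f = "mult_op (mpoly_ring n) f"
  note m = mult_op_all_dops[OF f]
  have e: "\<xi> \<in> endos n" using \<xi> by (rule all_dops_endos)
  have "compose (Pol n) \<xi> ?f = (\<lambda>x\<in>Pol n. \<eta> x + compose (Pol n) ?f \<xi> x)"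
    unfolding c(1)[symmetric] using f
    by (auto simp: compose_def mult_op_def comm_mult_def endosD[OF e])
  then have "\<Phi> (compose (Pol n) \<xi> ?f) = \<Phi> (\<lambda>x\<in>Pol n. \<eta> x + compose (Pol n) ?f \<xi> x)" by simp
  also have "\<dots> = (\<lambda>x\<in>Pol n. \<Phi> \<eta> x + \<Phi> (compose (Pol n) ?f \<xi>) x)"
    by (intro add c all_dops_compose[OF prime_p CHAR_p] m \<xi>)
  finally have "compose (Pol n) ?f (\<Phi> \<xi>) = (\<lambda>x\<in>Pol n. \<Phi> \<eta> x + compose (Pol n) (\<Phi> \<xi>) ?f x)"
    by (simp only: compose m \<xi> fixes_mult f)
  from fun_cong[OF this, of x] x
  have "compose (Pol n) ?f (\<Phi> \<xi>) x = \<Phi> \<eta> x + compose (Pol n) (\<Phi> \<xi>) ?f x" by simp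
  then show ?thesis
    using x f by (simp add: compose_def mult_op_def endosD[OF endos_image[OF \<xi>]])
qed

lemma dpd_op_all_dops: "a \<in> exps n \<Longrightarrow> (dpd_op n a :: 'k mpol \<Rightarrow> _) \<in> all_dops n"
  by (rule all_dopsI) (rule dpd_op_dops)

text \<open>Such a map is linear over the whole polynomial ring, hence multiplication by its value
  at \<open>1\<close>.\<close>

lemma commutes_with_vars:
  fixes \<delta> :: "'k mpol \<Rightarrow> 'k mpol"
  assumes add: "\<And>x y. x \<in> Pol n \<Longrightarrow> y \<in> Pol n \<Longrightarrow> \<delta> (x + y) = \<delta> x + \<delta> y"
    and smult: "\<And>c x. x \<in> Pol n \<Longrightarrow> \<delta> (monomial 0 c * x) = monomial 0 c * \<delta> x"
    and var: "\<And>i x. i < n \<Longrightarrow> x \<in> Pol n \<Longrightarrow> \<delta> (var i * x) = var i * \<delta> x"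
    and x: "x \<in> Pol n"
  shows "\<delta> x = x * \<delta> 1"
  using x
proof (induction rule: mpoly_ring_induct)
  case (add F G)
  then show ?case by (simp add: assms(1) distrib_right)
next
  case (monomial m c)
  then show ?case
  proof (induction rule: exps_induct)
    case zero
    then show ?case using smult[of 1 c] by simp
  next
    case (add i m)
    have "monomial (m + monomial i 1) c = var i * monomial m c"
      by (simp add: mult_single add.commute)
    then show ?case using var[OF add(1) single_in_carrier[OF add(2)], of c] add(3)
      by (simp only: mult.assoc)
  qed
qed

text \<open>The sign arises because \<open>\<Phi>\<close> negates commutators with variables, once
  for each unit of total degree.\<close>

lemma image_dpd_op:
  assumes "a \<in> exps n"
  shows "\<Phi> (dpd_op n a) = (\<lambda>x\<in>Pol n. monomial 0 ((- 1) ^ (\<Sum>i<n. coef a i)) * dpd n a x)"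
  using assms
proof (induction "\<Sum>i<n. coef a i" arbitrary: a rule: less_induct)
  case (less a)
  show ?case
  proof (cases "a = 0")
    case True
    have "(dpd_op n 0 :: 'k mpol \<Rightarrow> _) = mult_op (mpoly_ring n) 1" by (auto simp: mult_op_def dpd_0)
    then have "\<Phi> (dpd_op n 0) = dpd_op n 0" by (metis fixes_mult mpoly_ring_closed(6))
    then show ?thesis unfolding True by (simp del: restrict_apply)
  next
    case False
    define \<epsilon> :: "'k mpol" where "\<epsilon> = monomial 0 ((- 1) ^ (\<Sum>i<n. coef a i))"
    define \<zeta> where "\<zeta> = \<Phi> (dpd_op n a)"
    define \<delta> where "\<delta> x = \<zeta> x - \<epsilon> * dpd n a x" for x
    have e: "\<zeta> \<in> endos n"
      unfolding \<zeta>_def using less.prems by (intro endos_image dpd_op_all_dops)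
    have \<delta>: "\<delta> (var i * x) = var i * \<delta> x" if i: "i < n" and x: "x \<in> Pol n" for i x
    proof (cases "coef a i = 0")
      case True
      have "\<zeta> (var i * x) = var i * \<zeta> x - \<Phi> (\<lambda>x\<in>Pol n. 0) x"
        unfolding \<zeta>_def using all_dopsI[OF zero_dops]
        by (intro commutator_image dpd_op_all_dops less.prems comm_mult_dpd_op(2)[OF i True] var_Pol i x) blast
      then show ?thesis
        using x dpd_commute[OF i True, of x] by (simp add: zero \<delta>_def algebra_simps)
    next
      case False
      define b where "b = a - monomial i 1"
      have a: "a = b + monomial i 1"
        unfolding b_def using False
        by (auto intro!: poly_mapping_eqI simp: lookup_add lookup_minus lookup_single when_def)
      have b: "b \<in> exps n" using less.prems by (auto simp: b_def)
      have s: "(\<Sum>j<n. coef a j) = Suc (\<Sum>j<n. coef b j)"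
        using i by (simp add: a lookup_add sum.distrib lookup_single when_def)
      have \<epsilon>: "\<epsilon> = - monomial 0 ((- 1) ^ (\<Sum>j<n. coef b j))"
        unfolding \<epsilon>_def s by (simp add: single_uminus)
      have "\<Phi> (dpd_op n b) = (\<lambda>x\<in>Pol n. (- \<epsilon>) * dpd n b x)"
        using less.hyps[OF _ b] s unfolding \<epsilon> by simp
      moreover have "\<zeta> (var i * x) = var i * \<zeta> x - \<Phi> (dpd_op n b) x"
        unfolding \<zeta>_def
        by (intro commutator_image dpd_op_all_dops less.prems b var_Pol i x)
          (simp only: a comm_mult_dpd_op(1)[OF i])
      ultimately have "\<zeta> (var i * x) = var i * \<zeta> x + \<epsilon> * dpd n b x" using x by simp
      moreover have "dpd n a (var i * x) = var i * dpd n a x + dpd n b x"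
        using dpd_commutator[OF i, of b x] unfolding a by (simp add: algebra_simps)
      ultimately show ?thesis by (simp add: \<delta>_def algebra_simps)
    qed
    have \<delta>1: "\<delta> x = x * \<delta> 1" if "x \<in> Pol n" for x
    proof (rule commutes_with_vars[OF _ _ \<delta> that])
      fix x y :: "'k mpol" and c assume "x \<in> Pol n" "y \<in> Pol n"
      then show "\<delta> (x + y) = \<delta> x + \<delta> y"
        by (simp add: \<delta>_def endosD(3)[OF e] dpd_add algebra_simps)
    next
      fix x :: "'k mpol" and c assume "x \<in> Pol n"
      then show "\<delta> (monomial 0 c * x) = monomial 0 c * \<delta> x"
        by (simp add: \<delta>_def endosD(4)[OF e] dpd_smult right_diff_distrib mult.left_commute)
    qed
    obtain i where i: "i < n" "coef a i > 0"
    proof (rule ccontr)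
      assume "\<not> thesis"
      then have "a = 0" using less.prems that by (intro poly_mapping_eqI) (auto simp: exps_iff, metis gr0I not_le)
      with False show False by contradiction
    qed
    \<comment> \<open>\<open>tr_dpd\<close> requires \<open>q > a_i\<close>, and
      \<open>p ^ a_i > a_i\<close>.\<close>
    define q where "q = p ^ coef a i"
    have "coef a i < q"
      unfolding q_def by (rule power_gt_expt[OF prime_gt_Suc_0_nat[OF prime_p]])
    then have tr0: "tr n q (dpd n a x) = 0" for x :: "'k mpol"
      using i by (intro tr_dpd[OF prime_p CHAR_p q_def])
    define T :: "'k mpol \<Rightarrow> 'k mpol" where "T = dpd_op n (box n q)"
    have T: "T \<in> all_dops n" unfolding T_def by (rule dpd_op_all_dops) simp
    have "compose (Pol n) T (dpd_op n a) = (\<lambda>x\<in>Pol n. 0)"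
      by (auto simp: compose_def T_def dpd_in_carrier tr0)
    then have "\<Phi> (compose (Pol n) T (dpd_op n a)) = (\<lambda>x\<in>Pol n. 0)" by (simp only: zero)
    then have \<zeta>T: "compose (Pol n) \<zeta> (\<Phi> T) = (\<lambda>x\<in>Pol n. 0)"
      using compose[OF T dpd_op_all_dops[OF less.prems]] by (simp only: \<zeta>_def)
    \<comment> \<open>The trace of the monomial with exponent \<open>box n q\<close> is
      \<open>1\<close>. Injectivity then gives \<open>\<Phi> T \<noteq> 0\<close>.\<close>
    have "T \<noteq> (\<lambda>x\<in>Pol n. 0)"
    proof
      assume "T = (\<lambda>x\<in>Pol n. 0)"
      then have "T (monomial (box n q) 1) = 0" by (simp add: single_in_carrier)
      moreover have "corner n q (box n q)" using p_pow_pos by (simp add: corner_def q_def)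
      ultimately show False
        by (simp add: T_def single_in_carrier tr_monom[OF prime_p CHAR_p q_def])
    qed
    then have "\<Phi> T \<noteq> (\<lambda>x\<in>Pol n. 0)"
      using inj_on_eq_iff[OF inj T all_dopsI[OF zero_dops]] by (simp only: zero not_False_eq_True)
    then have "\<not> (\<forall>x\<in>Pol n. \<Phi> T x = 0)"
      using extensionalityI[OF endosD(1)[OF endos_image[OF T]] restrict_extensional, of "\<lambda>x. 0"] by auto
    then obtain x where x: "x \<in> Pol n" "\<Phi> T x \<noteq> 0" by blast
    have y: "\<Phi> T x \<in> Pol n" by (rule endosD(2)[OF endos_image[OF T] x(1)])
    have "\<zeta> (\<Phi> T x) = 0" using fun_cong[OF \<zeta>T, of x] x by (simp add: compose_def)
    \<comment> \<open>The nonzero polynomial \<open>\<Phi> T x\<close> is killed by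
      \<open>\<zeta>\<close>, which is \<open>\<epsilon> * dpd n a\<close> plus multiplication by
      \<open>\<delta> 1\<close>; leading terms forbid this unless
      \<open>\<delta> 1 = 0\<close>.\<close>
    have "\<epsilon> * dpd n a (\<Phi> T x) + \<delta> 1 * \<Phi> T x = \<epsilon> * dpd n a (\<Phi> T x) + \<delta> (\<Phi> T x)"
      by (simp only: \<delta>1[OF y] mult.commute)
    also have "\<dots> = 0" unfolding \<delta>_def by (simp add: \<open>\<zeta> (\<Phi> T x) = 0\<close>)
    finally have "\<delta> 1 = 0"
      using dpd_plus_mult_nonzero[OF False _ x(2)] unfolding \<epsilon>_def by blast
    then have "\<zeta> x = \<epsilon> * dpd n a x" if "x \<in> Pol n" for x
      using \<delta>1[OF that] by (simp add: \<delta>_def)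
    moreover have "\<zeta> \<in> extensional (Pol n)" by (rule endosD(1)[OF e])
    ultimately show ?thesis
      unfolding \<zeta>_def[symmetric] \<epsilon>_def[symmetric]
      by (intro extensionalityI[of _ "Pol n"]) auto
  qed
qed

text \<open>A sandwich is built from multiplications, which \<open>\<Phi>\<close> fixes, and the
  trace, whose image is known. The sign may stay unevaluated: what matters is that the result does
  not mention \<open>\<Phi>\<close>.\<close>

lemma image_sandwich:
  assumes "\<And>a. a \<in> A \<Longrightarrow> u a \<in> Pol n" "\<And>a. a \<in> A \<Longrightarrow> v a \<in> Pol n"
  shows "\<Phi> (sandwich n q A u v) = (\<lambda>x\<in>Pol n. \<Sum>a\<in>A.
    v a * (monomial 0 ((- 1) ^ (\<Sum>i<n. coef (box n q) i)) * tr n q (u a * x)))"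
  using assms
proof (induction A rule: infinite_finite_induct)
  case (insert a A)
  let ?T = "dpd_op n (box n q) :: 'k mpol \<Rightarrow> 'k mpol"
  let ?u = "mult_op (mpoly_ring n) (u a)" and ?v = "mult_op (mpoly_ring n) (v a)"
  have u: "u a \<in> Pol n" and v: "v a \<in> Pol n" using insert by auto
  note uv = mult_op_all_dops[OF u] mult_op_all_dops[OF v]
  have T: "?T \<in> all_dops n" by (rule dpd_op_all_dops) simp
  note c = all_dops_compose[OF prime_p CHAR_p]
  have "sandwich n q (insert a A) u v
    = (\<lambda>x\<in>Pol n. compose (Pol n) ?u (compose (Pol n) ?T ?v) x + sandwich n q A u v x)"
    using insert u v by (auto simp: sandwich_def compose_def mult_op_def dpd_in_carrier)
  then have "\<Phi> (sandwich n q (insert a A) u v)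
    = (\<lambda>x\<in>Pol n. \<Phi> (compose (Pol n) ?u (compose (Pol n) ?T ?v)) x + \<Phi> (sandwich n q A u v) x)"
    using add[OF c[OF uv(1) c[OF T uv(2)]] sandwich_dops[of A u n v q]] insert by simp
  also have "\<Phi> (compose (Pol n) ?u (compose (Pol n) ?T ?v))
    = compose (Pol n) (compose (Pol n) ?v (\<Phi> ?T)) ?u"
    by (simp only: compose uv T c fixes_mult u v)
  also have "\<Phi> ?T = (\<lambda>x\<in>Pol n. monomial 0 ((- 1) ^ (\<Sum>i<n. coef (box n q) i)) * tr n q x)"
    by (rule image_dpd_op) simp
  finally show ?case
    using insert u v by (auto simp: compose_def mult_op_def dpd_in_carrier)
qed (simp_all add: sandwich_def zero)

lemma image_eq:
  assumes "\<xi> \<in> qlin n (p ^ e)"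
  shows "\<Phi> \<xi> = (\<lambda>x\<in>Pol n. \<Sum>a\<in>cube n (p ^ e). monomial (box n (p ^ e) - a) 1 *
    (monomial 0 ((- 1) ^ (\<Sum>i<n. coef (box n (p ^ e)) i)) * tr n (p ^ e) (\<xi> (monomial a 1) * x)))"
proof -
  have "\<xi> \<in> endos n" using assms by (simp add: qlin_def)
  then have "\<xi> (monomial a 1) \<in> Pol n" if "a \<in> cube n (p ^ e)" for a
    using that by (intro endosD(2)[of \<xi>] single_in_carrier) (auto simp: cube_def)
  moreover have "monomial (box n (p ^ e) - a) (1::'k) \<in> Pol n" for a
    by (intro single_in_carrier) auto
  ultimately show ?thesis
    using image_sandwich[of "cube n (p ^ e)" "\<lambda>a. \<xi> (monomial a 1)" "\<lambda>a. monomial (box n (p ^ e) - a) 1" "p ^ e"]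
      qlin_eq_sandwich[OF prime_p CHAR_p refl assms] by simp
qed

end

section \<open>Uniqueness and the conclusion\<close>

lemma fixing_anti_hom_unique:
  fixes \<Phi> \<Psi> :: "('k::field mpol \<Rightarrow> 'k mpol) \<Rightarrow> 'k mpol \<Rightarrow> 'k mpol"
  assumes "fixing_anti_hom p n \<Phi>" "fixing_anti_hom p n \<Psi>" "\<xi> \<in> all_dops n"
  shows "\<Phi> \<xi> = \<Psi> \<xi>"
proof -
  interpret \<Phi>: fixing_anti_hom p n "TYPE('k)" \<Phi> by fact
  interpret \<Psi>: fixing_anti_hom p n "TYPE('k)" \<Psi> by fact
  obtain e where "\<xi> \<in> qlin n (p ^ e)"
    using assms(3) unfolding all_dops_eq[OF \<Phi>.prime_p \<Phi>.CHAR_p] by blast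
  then show ?thesis by (simp only: \<Phi>.image_eq \<Psi>.image_eq)
qed

lemma diff_op_ring_simps:
  fixes n :: nat
  defines "A \<equiv> diff_op_ring (ring_of_type_algebra :: 'k::field ring) (mpoly_ring n)"
  shows "carrier A = all_dops n" "\<one>\<^bsub>A\<^esub> = (\<lambda>x\<in>Pol n. x)"
    "\<xi> \<oplus>\<^bsub>A\<^esub> \<eta> = (\<lambda>x\<in>Pol n. \<xi> x + \<eta> x)" "\<xi> \<otimes>\<^bsub>A\<^esub> \<eta> = compose (Pol n) \<xi> \<eta>"
  by (simp_all add: A_def diff_op_ring_def End_ring_def all_dops_def del: restrict_apply)

theorem theorem4p10:
  fixes n p :: nat
  defines "K \<equiv> (ring_of_type_algebra :: 'k::field ring)"
    and "R \<equiv> (mpoly_ring n :: ('k, (nat \<Rightarrow>\<^sub>0 nat) \<Rightarrow>\<^sub>0 'k) module)"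
  assumes "perfect_field TYPE('k)"
    and "CHAR('k) = p" and "p > 0"
  shows "\<exists>!\<Phi>. \<Phi> \<in> ring_anti_automorphisms (diff_op_ring K R) \<and>
           (\<forall>f\<in>carrier R. \<Phi> (mult_op R f) = mult_op R f)"
proof -
  \<comment> \<open>Positive characteristic of a field is prime.\<close>
  interpret prime_char p n "TYPE('k)"
    using assms prime_CHAR_semidom[where ?'a = 'k] by unfold_locales auto
  show ?thesis
  proof (rule ex1I[of _ adjoint])
    have "bij_betw adjoint (all_dops n) (all_dops n)"
      by (rule bij_betwI[of _ _ _ adjoint]) (auto simp: adjoint_adjoint adjoint(1))
    \<comment> \<open>The unit of the ring is multiplication by \<open>1\<close>, hence fixed by
      \<open>adjoint\<close>.\<close>
    moreover have "mult_op (mpoly_ring n) 1 = (\<lambda>x\<in>Pol n. (x :: 'k mpol))"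
      by (auto simp: mult_op_def)
    then have "adjoint (\<lambda>x\<in>Pol n. x) = (\<lambda>x\<in>Pol n. x)"
      using adjoint_mult_op[of 1] by simp
    moreover have "adjoint \<in> extensional (all_dops n)" unfolding adjoint_def by simp
    ultimately show "adjoint \<in> ring_anti_automorphisms (diff_op_ring K R) \<and>
        (\<forall>f\<in>carrier R. adjoint (mult_op R f) = mult_op R f)"
      unfolding ring_anti_automorphisms_def K_def R_def diff_op_ring_simps
      by (simp add: adjoint_add adjoint_compose adjoint_mult_op del: restrict_apply)
  next
    fix \<Phi> assume \<Phi>: "\<Phi> \<in> ring_anti_automorphisms (diff_op_ring K R) \<and>
        (\<forall>f\<in>carrier R. \<Phi> (mult_op R f) = mult_op R f)"
    note \<Phi>' = \<Phi>[unfolded ring_anti_automorphisms_def K_def R_def diff_op_ring_simps mem_Collect_eq]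
    have "fixing_anti_hom p n \<Phi>"
      by unfold_locales (use \<Phi>' in \<open>auto simp: bij_betw_def simp del: restrict_apply\<close>)
    moreover have "fixing_anti_hom p n adjoint"
      by unfold_locales (auto simp: adjoint_add adjoint_compose adjoint_mult_op adjoint(1)
        intro!: inj_on_inverseI[of _ adjoint] adjoint_adjoint simp del: restrict_apply)
    ultimately have "\<Phi> \<xi> = adjoint \<xi>" if "\<xi> \<in> all_dops n" for \<xi>
      using fixing_anti_hom_unique that by blast
    \<comment> \<open>Outside the ring both maps are \<open>undefined\<close>, so agreement on
      differential operators gives equality.\<close>
    moreover have "\<Phi> \<in> extensional (all_dops n)" using \<Phi>' by blast
    moreover have "adjoint \<in> extensional (all_dops n)" unfolding adjoint_def by simp
    ultimately show "\<Phi> = adjoint" by (intro extensionalityI[of _ "all_dops n"])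
  qed
qed

end
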